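(* Let $S\subset\mathbb{R}^m$ be a semialgebraic set that is the image of a quasi-polynomial map $f:\mathbb{R}^n\to\mathbb{R}^m$. Then the set $S_\infty$ of points at infinity of $S$ is connected.
   Context: For $\mathbb{K}=\mathbb{R}$ or $\mathbb{C}$, the projective space $\mathbb{K}\mathbb{P}^m$, with homogeneous coordinates $(x_0:x_1:\cdots:x_m)$, contains $\mathbb{K}^m$ as the set of points with $x_0=1$, and its hyperplane at infinity is $\mathsf{H}^m_\infty(\mathbb{K}):=\{x_0=0\}$. For a semialgebraic set $S\subset\mathbb{R}^m$, the set of points at infinity of $S$ is $S_\infty:=\mathrm{Cl}_{\mathbb{R}\mathbb{P}^m}(S)\cap\mathsf{H}^m_\infty(\mathbb{R})$, where $\mathrm{Cl}_{\mathbb{R}\mathbb{P}^m}$ denotes closure in $\mathbb{R}\mathbb{P}^m$ (Euclidean topology). A map $f:\mathbb{R}^n\to\mathbb{R}^m$ is regular if each of its components is a quotient of two polynomials of $\mathbb{R}[x_1,\ldots,x_n]$ whose denominator has no zero in $\mathbb{R}^n$. Taking a common denominator, write $$f=\Big(\frac{f_1}{f_0},\ldots,\frac{f_m}{f_0}\Big),$$ where each $f_i\in\mathbb{R}[x_1,\ldots,x_n]$ and $f_0$ has no zero in $\mathbb{R}^n$. Let $d:=\max_{i=0,\ldots,m}\{\deg(f_i)\}$ and $F_i(x_0,x_1,\ldots,x_n):=x_0^d f_i\big(\frac{x_1}{x_0},\ldots,\frac{x_n}{x_0}\big)$ for $i=0,\ldots,m$, and consider the rational map $$F_{\mathbb{C}}:\mathbb{C}\mathbb{P}^n\dashrightarrow\mathbb{C}\mathbb{P}^m,\quad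 x=(x_0:x_1:\cdots:x_n)\mapsto(F_0(x):F_1(x):\cdots:F_m(x)).$$ Let $Y_{\mathbb{C}}\subset\mathbb{C}\mathbb{P}^n$ be the set of indeterminacy of $F_{\mathbb{C}}$, i.e. the set of points at which the rational map $F_{\mathbb{C}}$ fails to be regular. Write $F_0=x_0^eF_0'$ where $e\geq0$ and $F_0'\in\mathbb{R}[x_0,x_1,\ldots,x_n]$ is a homogeneous polynomial not divisible by $x_0$. The regular map $f$ is called a quasi-polynomial map if $F_{\mathbb{C}}(\mathsf{H}^n_\infty(\mathbb{C}))\subset\mathsf{H}^m_\infty(\mathbb{C})$ (equivalently, $\max\{\deg(f_1),\ldots,\deg(f_m)\}-\deg(f_0)>0$) and no real indeterminacy point of $F_{\mathbb{C}}$ belongs to $\{F_0'=0\}$, that is, $Y_{\mathbb{C}}\cap\mathbb{R}\mathbb{P}^n\cap\{F_0'=0\}=\varnothing$. *)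

theory Defs
  imports "HOL-Analysis.Analysis" "HOL-Library.Poly_Mapping"
begin

subsection \<open>Polynomials in the variables \<open>x\<^sub>i\<close>, \<open>i\<close> ranging over a finite type\<close>

text \<open>A polynomial is a finitely supported function from exponent vectors to coefficients;
  the ring structure (convolution product) is the one of \<open>Poly_Mapping\<close>.\<close>

type_synonym ('a, 'n) mpoly = "('n \<Rightarrow>\<^sub>0 nat) \<Rightarrow>\<^sub>0 'a"

definition mvar :: "'n \<Rightarrow> ('a::comm_ring_1, 'n) mpoly" where
  "mvar i = Poly_Mapping.single (Poly_Mapping.single i 1) 1"

definition mono_deg :: "('n::finite \<Rightarrow>\<^sub>0 nat) \<Rightarrow> nat" where
  "mono_deg m = (\<Sum>i\<in>UNIV. Poly_Mapping.lookup m i)"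

definition peval :: "('a::comm_ring_1, 'n::finite) mpoly \<Rightarrow> 'a^'n \<Rightarrow> 'a" where
  "peval p x = (\<Sum>m\<in>Poly_Mapping.keys p.
      Poly_Mapping.lookup p m * (\<Prod>i\<in>UNIV. x $ i ^ Poly_Mapping.lookup m i))"

text \<open>Convention: the zero polynomial has degree \<open>0\<close>.  This is harmless below, where degrees are
  only used in a maximum that involves at least one nonzero polynomial.\<close>

definition total_degree :: "('a::zero, 'n::finite) mpoly \<Rightarrow> nat" where
  "total_degree p = Max (insert 0 (mono_deg ` Poly_Mapping.keys p))"

definition homogeneous :: "nat \<Rightarrow> ('a::zero, 'n::finite) mpoly \<Rightarrow> bool" where
  "homogeneous k p \<longleftrightarrow> (\<forall>m\<in>Poly_Mapping.keys p. mono_deg m = k)"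

text \<open>Homogeneous coordinates \<open>(x\<^sub>0 : x\<^sub>1 : \<dots> : x\<^sub>n)\<close> are indexed by \<open>'n option\<close>: the index \<open>0\<close> is
  \<open>None\<close>, and the affine coordinates \<open>i\<close> are \<open>Some i\<close>.  For \<open>d\<close> at least the degree of \<open>p\<close>,
  \<open>homogenize d p\<close> is the polynomial \<open>x\<^sub>0\<^sup>d p(x\<^sub>1/x\<^sub>0, \<dots>, x\<^sub>n/x\<^sub>0)\<close>; see \<open>peval_homogenize\<close> below.\<close>

definition homogenize_mono :: "nat \<Rightarrow> ('n::finite \<Rightarrow>\<^sub>0 nat) \<Rightarrow> ('n option \<Rightarrow>\<^sub>0 nat)" where
  "homogenize_mono d m = Abs_poly_mapping
     (\<lambda>j. case j of None \<Rightarrow> d - mono_deg m | Some i \<Rightarrow> Poly_Mapping.lookup m i)"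

definition homogenize ::
  "nat \<Rightarrow> ('a::comm_ring_1, 'n::finite) mpoly \<Rightarrow> ('a, 'n option) mpoly" where
  "homogenize d p = (\<Sum>m\<in>Poly_Mapping.keys p.
     Poly_Mapping.single (homogenize_mono d m) (Poly_Mapping.lookup p m))"

lemma lookup_homogenize_mono:
  "Poly_Mapping.lookup (homogenize_mono d m) j =
     (case j of None \<Rightarrow> d - mono_deg m | Some i \<Rightarrow> Poly_Mapping.lookup m i)"
  unfolding homogenize_mono_def by (subst lookup_Abs_poly_mapping) auto

lemma homogenize_mono_eq_iff [simp]: "homogenize_mono d m = homogenize_mono d m' \<longleftrightarrow> m = m'"
proof
  assume "homogenize_mono d m = homogenize_mono d m'"
  then have "Poly_Mapping.lookup (homogenize_mono d m) (Some i) =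
      Poly_Mapping.lookup (homogenize_mono d m') (Some i)" for i by simp
  then show "m = m'" by (intro poly_mapping_eqI) (simp add: lookup_homogenize_mono)
qed simp

lemma lookup_homogenize:
  "Poly_Mapping.lookup (homogenize d p) (homogenize_mono d m) = Poly_Mapping.lookup p m"
proof -
  have "Poly_Mapping.lookup (homogenize d p) (homogenize_mono d m) =
      (\<Sum>k\<in>Poly_Mapping.keys p. if k = m then Poly_Mapping.lookup p m else 0)"
    unfolding homogenize_def lookup_sum
    by (intro sum.cong) (auto simp: lookup_single when_def)
  also have "\<dots> = Poly_Mapping.lookup p m" by (simp add: in_keys_iff)
  finally show ?thesis .
qed

lemma keys_homogenize:
  "Poly_Mapping.keys (homogenize d p) = homogenize_mono d ` Poly_Mapping.keys p"
proof
  show "Poly_Mapping.keys (homogenize d p) \<subseteq> homogenize_mono d ` Poly_Mapping.keys p"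
    unfolding homogenize_def
    by (rule order_trans[OF keys_sum]) auto
qed (auto simp: in_keys_iff lookup_homogenize)

lemma prod_UNIV_option: "(\<Prod>j\<in>UNIV. f j) = f None * (\<Prod>i\<in>UNIV. f (Some i))"
  for f :: "'n::finite option \<Rightarrow> 'a::comm_monoid_mult"
  by (simp add: UNIV_option_conv prod.reindex)

lemma peval_homogenize:
  fixes p :: "('a::field, 'n::finite) mpoly"
  assumes "total_degree p \<le> d" and "x $ None \<noteq> 0"
  shows "peval (homogenize d p) x = (x $ None) ^ d * peval p (\<chi> i. x $ Some i / x $ None)"
proof -
  have le: "mono_deg m \<le> d" if "m \<in> Poly_Mapping.keys p" for m
    using assms(1) that unfolding total_degree_def by simp
  have "peval (homogenize d p) x = (\<Sum>m\<in>Poly_Mapping.keys p. Poly_Mapping.lookup p m *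
      ((x $ None) ^ (d - mono_deg m) * (\<Prod>i\<in>UNIV. x $ Some i ^ Poly_Mapping.lookup m i)))"
    unfolding peval_def keys_homogenize
    by (simp add: sum.reindex inj_on_def lookup_homogenize prod_UNIV_option lookup_homogenize_mono)
  also have "\<dots> = (\<Sum>m\<in>Poly_Mapping.keys p. Poly_Mapping.lookup p m * ((x $ None) ^ d *
      (\<Prod>i\<in>UNIV. (x $ Some i / x $ None) ^ Poly_Mapping.lookup m i)))"
  proof (rule sum.cong[OF refl])
    fix m assume m: "m \<in> Poly_Mapping.keys p"
    have "(\<Prod>i\<in>UNIV. (x $ Some i / x $ None) ^ Poly_Mapping.lookup m i) =
        (\<Prod>i\<in>UNIV. x $ Some i ^ Poly_Mapping.lookup m i) / (x $ None) ^ mono_deg m"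
      by (simp add: power_divide prod_dividef mono_deg_def power_sum)
    then show "Poly_Mapping.lookup p m * ((x $ None) ^ (d - mono_deg m) *
          (\<Prod>i\<in>UNIV. x $ Some i ^ Poly_Mapping.lookup m i)) =
        Poly_Mapping.lookup p m * ((x $ None) ^ d *
          (\<Prod>i\<in>UNIV. (x $ Some i / x $ None) ^ Poly_Mapping.lookup m i))"
      using le[OF m] assms(2) by (simp add: power_diff)
  qed
  also have "\<dots> = (x $ None) ^ d * peval p (\<chi> i. x $ Some i / x $ None)"
    unfolding peval_def sum_distrib_left by (simp add: mult_ac)
  finally show ?thesis .
qed

subsection \<open>Projective space\<close>

text \<open>\<open>('a, 'n) proj\<close> is the projective space of dimension \<open>CARD('n)\<close> over the field \<open>'a\<close>: nonzero
  coordinate vectors up to a nonzero scalar.  The projection \<open>abs_proj\<close> is meaningful on nonzero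
  vectors only.\<close>

definition proj_rel :: "'a::field^('n::finite option) \<Rightarrow> 'a^('n option) \<Rightarrow> bool" where
  "proj_rel x y \<longleftrightarrow> x \<noteq> 0 \<and> y \<noteq> 0 \<and> (\<exists>c. c \<noteq> 0 \<and> y = c *s x)"

quotient_type (overloaded) ('a, 'n) proj = "'a::field^('n::finite option)" / partial: proj_rel
proof (rule part_equivpI)
  have "proj_rel (1::'a^('n option)) 1"
    unfolding proj_rel_def by (auto intro!: exI[of _ 1])
  then show "\<exists>x::'a^('n option). proj_rel x x" ..
  show "symp (proj_rel :: 'a^('n option) \<Rightarrow> _)"
  proof (rule sympI)
    fix x y :: "'a^('n option)"
    assume "proj_rel x y"
    then obtain c where "x \<noteq> 0" "y \<noteq> 0" "c \<noteq> 0" "y = c *s x"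
      unfolding proj_rel_def by blast
    then show "proj_rel y x"
      unfolding proj_rel_def
      by (intro conjI exI[of _ "inverse c"]) (auto simp: vec_eq_iff)
  qed
  show "transp (proj_rel :: 'a^('n option) \<Rightarrow> _)"
  proof (rule transpI)
    fix x y z :: "'a^('n option)"
    assume "proj_rel x y" "proj_rel y z"
    then obtain c e where "x \<noteq> 0" "z \<noteq> 0" "c \<noteq> 0" "y = c *s x" "e \<noteq> 0" "z = e *s y"
      unfolding proj_rel_def by blast
    then show "proj_rel x z"
      unfolding proj_rel_def
      by (intro conjI exI[of _ "e * c"]) (auto simp: vec_eq_iff)
  qed
qed

lemma abs_proj_eq_iff:
  assumes "x \<noteq> 0" "y \<noteq> 0"
  shows "abs_proj x = abs_proj y \<longleftrightarrow> (\<exists>c. c \<noteq> 0 \<and> y = c *s x)"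
proof -
  have "proj_rel x x" "proj_rel y y"
    using assms unfolding proj_rel_def by (auto intro!: exI[of _ 1])
  then show ?thesis
    using assms Quotient_rel[OF Quotient_proj, of x y] unfolding proj_rel_def by auto
qed

text \<open>The quotient topology; over the reals this is the Euclidean topology of real projective
  space.\<close>

instantiation proj :: ("{field, t1_space}", finite) topological_space
begin

definition open_proj :: "('a, 'b) proj set \<Rightarrow> bool" where
  "open_proj U \<longleftrightarrow> open {x. x \<noteq> 0 \<and> abs_proj x \<in> U}"

instance
proof
  have "{x::'a^('b option). x \<noteq> 0} = (\<Union>j. {x. x $ j \<noteq> 0})"
    by (auto simp: vec_eq_iff)
  moreover have "open {x::'a^('b option). x $ j \<noteq> 0}" for j
  proof -
    have "open ((\<lambda>x::'a^('b option). x $ j) -` (- {0}))"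
      by (intro open_vimage_vec_nth) auto
    then show ?thesis by (simp add: vimage_def)
  qed
  ultimately show "open (UNIV :: ('a, 'b) proj set)"
    unfolding open_proj_def by auto
next
  fix U V :: "('a, 'b) proj set"
  assume "open U" "open V"
  then have "open ({x. x \<noteq> 0 \<and> abs_proj x \<in> U} \<inter> {x. x \<noteq> 0 \<and> abs_proj x \<in> V})"
    unfolding open_proj_def by (rule open_Int)
  also have "{x. x \<noteq> 0 \<and> abs_proj x \<in> U} \<inter> {x. x \<noteq> 0 \<and> abs_proj x \<in> V} =
      {x. x \<noteq> 0 \<and> abs_proj x \<in> U \<inter> V}" by auto
  finally show "open (U \<inter> V)" unfolding open_proj_def .
next
  fix K :: "('a, 'b) proj set set"
  assume "\<forall>U\<in>K. open U"
  then have "open (\<Union>U\<in>K. {x. x \<noteq> 0 \<and> abs_proj x \<in> U})"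
    unfolding open_proj_def by blast
  also have "(\<Union>U\<in>K. {x. x \<noteq> 0 \<and> abs_proj x \<in> U}) = {x. x \<noteq> 0 \<and> abs_proj x \<in> \<Union>K}" by auto
  finally show "open (\<Union>K)" unfolding open_proj_def .
qed

end

text \<open>The embedding \<open>(x\<^sub>1, \<dots>, x\<^sub>m) \<mapsto> (1 : x\<^sub>1 : \<dots> : x\<^sub>m)\<close> and the hyperplane at infinity.\<close>

definition affine_embed :: "'a::field^'n::finite \<Rightarrow> ('a, 'n) proj" where
  "affine_embed x = abs_proj (\<chi> j. case j of None \<Rightarrow> 1 | Some i \<Rightarrow> x $ i)"

definition hyperplane_at_infinity :: "('a::field, 'n::finite) proj set" where
  "hyperplane_at_infinity = {abs_proj x | x. x \<noteq> 0 \<and> x $ None = 0}"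

definition points_at_infinity :: "(real^'m::finite) set \<Rightarrow> (real, 'm) proj set" where
  "points_at_infinity S = closure (affine_embed ` S) \<inter> hyperplane_at_infinity"

definition real_points :: "(complex, 'n::finite) proj set" where
  "real_points = {abs_proj (\<chi> j. complex_of_real (x $ j)) | x. x \<noteq> 0}"

definition proj_zeros :: "('a::field, 'n::finite option) mpoly \<Rightarrow> ('a, 'n) proj set" where
  "proj_zeros p = {abs_proj x | x. x \<noteq> 0 \<and> peval p x = 0}"

subsection \<open>Rational maps between projective spaces\<close>

text \<open>\<open>F\<close> is a tuple of homogeneous polynomials of the same degree, not all zero.  The same rational
  map is given by every tuple \<open>G\<close> of homogeneous polynomials of a common degree, not all zero, with
  \<open>F\<^sub>i G\<^sub>j = F\<^sub>j G\<^sub>i\<close>.  It is regular at \<open>P\<close> if some such \<open>G\<close> has no common zero at \<open>P\<close>, and then its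
  value is \<open>(G\<^sub>0(P) : \<dots> : G\<^sub>m(P))\<close>.\<close>

definition rational_map_value :: "('m::finite option \<Rightarrow> ('a::field, 'n::finite option) mpoly) \<Rightarrow>
    ('a, 'n) proj \<Rightarrow> ('a, 'm) proj \<Rightarrow> bool" where
  "rational_map_value F P Q \<longleftrightarrow>
     (\<exists>G k x. (\<forall>j. homogeneous k (G j)) \<and> (\<forall>i j. F i * G j = F j * G i) \<and>
        x \<noteq> 0 \<and> P = abs_proj x \<and>
        (\<chi> j. peval (G j) x) \<noteq> 0 \<and> Q = abs_proj (\<chi> j. peval (G j) x))"

definition indeterminacy_set :: "('m::finite option \<Rightarrow> ('a::field, 'n::finite option) mpoly) \<Rightarrow>
    ('a, 'n) proj set" where
  "indeterminacy_set F = {P. \<nexists>Q. rational_map_value F P Q}"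

text \<open>As usual, the image of a set under a rational map is the image of its points of regularity.\<close>

definition rational_map_image :: "('m::finite option \<Rightarrow> ('a::field, 'n::finite option) mpoly) \<Rightarrow>
    ('a, 'n) proj set \<Rightarrow> ('a, 'm) proj set" where
  "rational_map_image F A = {Q. \<exists>P\<in>A. rational_map_value F P Q}"

subsection \<open>Semialgebraic sets, regular maps, quasi-polynomial maps\<close>

inductive semialgebraic :: "(real^'n::finite) set \<Rightarrow> bool" where
  semialgebraic_eq: "semialgebraic {x. peval p x = 0}"
| semialgebraic_gt: "semialgebraic {x. peval p x > 0}"
| semialgebraic_Compl: "semialgebraic A \<Longrightarrow> semialgebraic (- A)"
| semialgebraic_Un: "semialgebraic A \<Longrightarrow> semialgebraic B \<Longrightarrow> semialgebraic (A \<union> B)"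
| semialgebraic_Int: "semialgebraic A \<Longrightarrow> semialgebraic B \<Longrightarrow> semialgebraic (A \<inter> B)"

definition regular_map :: "(real^'n::finite \<Rightarrow> real^'m::finite) \<Rightarrow> bool" where
  "regular_map f \<longleftrightarrow> (\<forall>i. \<exists>p q. (\<forall>x. peval q x \<noteq> 0) \<and> (\<forall>x. f x $ i = peval p x / peval q x))"

text \<open>\<open>f = (f\<^sub>1/f\<^sub>0, \<dots>, f\<^sub>m/f\<^sub>0)\<close>, where \<open>g None = f\<^sub>0\<close> and \<open>g (Some i) = f\<^sub>i\<close>.\<close>

definition represents :: "('m::finite option \<Rightarrow> (real, 'n::finite) mpoly) \<Rightarrow>
    (real^'n \<Rightarrow> real^'m) \<Rightarrow> bool" where
  "represents g f \<longleftrightarrow> (\<forall>x. peval (g None) x \<noteq> 0) \<and>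
     (\<forall>x i. f x $ i = peval (g (Some i)) x / peval (g None) x)"

definition homogenized :: "('m::finite option \<Rightarrow> (real, 'n::finite) mpoly) \<Rightarrow>
    ('m option \<Rightarrow> (real, 'n option) mpoly)" where
  "homogenized g j = homogenize (MAX i. total_degree (g i)) (g j)"

definition complexify :: "(real, 'n) mpoly \<Rightarrow> (complex, 'n) mpoly" where
  "complexify p = Poly_Mapping.map complex_of_real p"

text \<open>The rational map \<open>F\<close> and its indeterminacy do not depend on the common denominator, but the
  zero set of \<open>F\<^sub>0'\<close> can only grow when \<open>f\<^sub>0, \<dots>, f\<^sub>m\<close> have a common factor.  Hence asking the
  conditions for some representation is the same as asking them for the one in lowest terms.\<close>

definition quasi_polynomial_map :: "(real^'n::finite \<Rightarrow> real^'m::finite) \<Rightarrow> bool" where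
  "quasi_polynomial_map f \<longleftrightarrow> regular_map f \<and>
     (\<exists>g. represents g f \<and>
        (let F = homogenized g; FC = (\<lambda>j. complexify (F j)) in
          rational_map_image FC hyperplane_at_infinity \<subseteq> hyperplane_at_infinity \<and>
          (\<exists>e F0' k. F None = mvar None ^ e * F0' \<and> homogeneous k F0' \<and> \<not> mvar None dvd F0' \<and>
             indeterminacy_set FC \<inter> real_points \<inter> proj_zeros (complexify F0') = {})))"

end

theory Submission
  imports Defs "HOL-Computational_Algebra.Polynomial"
begin

text \<open>A point at infinity of \<open>S\<close> is a limit of directions of \<open>F(x\<^sub>k)\<close>, where \<open>F\<close> is the
  homogenization of \<open>f\<close> and \<open>x\<^sub>k\<close> tends to a point \<open>P\<close> at infinity of the source.  The directions
  \<open>F(w)\<close> with \<open>w\<close> at infinity and \<open>F(w) \<noteq> 0\<close> are joined to each other by the rational curves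
  \<open>c \<mapsto> (F(w + c (w' - w)))\<close>.  If \<open>P\<close> is a point of regularity, then the limit lies in the closure of
  these directions.  Otherwise \<open>F\<^sub>0'(P) \<noteq> 0\<close>, so that \<open>F\<^sub>0\<close> hardly changes when one moves from \<open>x\<^sub>k\<close> in a
  direction \<open>v\<close> with \<open>v\<^sub>0 = 0\<close>.  Writing \<open>F(x + t v) = \<Sum>\<^sub>j t\<^sup>j C\<^sub>j(x)\<close>, the gauge
  \<open>\<Sum>\<^sub>j t\<^sup>j |C\<^sub>j(x\<^sub>k)|\<close> increases with \<open>t\<close>, hence dominates \<open>F\<^sub>0\<close> all along the way, and at every scale
  \<open>t = c l\<^sub>k\<close> the rescaled limit of \<open>F(x\<^sub>k + t v)\<close> is a polynomial curve of points at infinity of \<open>S\<close>.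
  These curves, scale after scale, connect the limit to a direction \<open>F(w)\<close> with \<open>w\<close> at infinity.\<close>

subsection \<open>Polynomial curves\<close>

lemma islimpt_Diff_finite:
  fixes x :: "'a::t1_space"
  assumes "finite Z" "x islimpt S"
  shows "x islimpt (S - Z)"
proof -
  have "x islimpt (Z \<union> (S - Z))"
    using assms(2) by (rule islimpt_subset) auto
  then show ?thesis
    unfolding islimpt_Un_finite[OF assms(1)] .
qed

lemma islimpt_atLeastAtMost:
  fixes c :: real
  assumes "c \<in> {a..b}" "a < b"
  shows "c islimpt {a..b}"
  using assms by (intro connected_imp_perfect) auto

lemma common_convergent_subsequence:
  fixes B :: "nat \<Rightarrow> nat \<Rightarrow> 'a::heine_borel"
  assumes "\<And>j. j \<le> D \<Longrightarrow> bounded (range (\<lambda>k. B k j))"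
  shows "\<exists>s b. strict_mono s \<and> (\<forall>j\<le>D. (\<lambda>k. B (s k) j) \<longlonglongrightarrow> b j)"
  using assms
proof (induction D)
  case 0
  then obtain l s where "strict_mono s" "((\<lambda>k. B k 0) \<circ> s) \<longlonglongrightarrow> l"
    using bounded_imp_convergent_subsequence[of "\<lambda>k. B k 0"] by auto
  then show ?case by (intro exI[of _ s] exI[of _ "\<lambda>_. l"]) (simp add: o_def)
next
  case (Suc D)
  then obtain s b where s: "strict_mono s" "\<And>j. j \<le> D \<Longrightarrow> (\<lambda>k. B (s k) j) \<longlonglongrightarrow> b j"
    by (metis le_SucI)
  have "bounded (range (\<lambda>k. B (s k) (Suc D)))"
    using Suc.prems[of "Suc D"] by (auto intro: bounded_subset)
  then obtain l t where t: "strict_mono t" "((\<lambda>k. B (s k) (Suc D)) \<circ> t) \<longlonglongrightarrow> l"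
    using bounded_imp_convergent_subsequence[of "\<lambda>k. B (s k) (Suc D)"] by auto
  have "(\<lambda>k. B ((s \<circ> t) k) j) \<longlonglongrightarrow> (b(Suc D := l)) j" if "j \<le> Suc D" for j
  proof (cases "j = Suc D")
    case True
    then show ?thesis using t(2) by (simp add: o_def)
  next
    case False
    then show ?thesis
      using LIMSEQ_subseq_LIMSEQ[OF s(2) t(1), of j] that by (simp add: o_def)
  qed
  with strict_mono_o[OF s(1) t(1)] show ?case by blast
qed

text \<open>Induction on the degree of the nonzero member \<open>p j\<close>: while all members
  share a root \<open>c\<close> in the field, its linear factor is split off from each. Factors
  without roots may stay common to all \<open>r i\<close>; only common zeros matter.\<close>

lemma poly_family_common_factor:
  fixes p :: "'i \<Rightarrow> 'a::field poly"
  assumes "p j \<noteq> 0"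
  shows "\<exists>g r. g \<noteq> 0 \<and> (\<forall>i. p i = g * r i) \<and> (\<forall>c. \<exists>i. poly (r i) c \<noteq> 0)"
  using assms
proof (induction "degree (p j)" arbitrary: p rule: less_induct)
  case less
  show ?case
  proof (cases "\<exists>c. \<forall>i. poly (p i) c = 0")
    case False
    then show ?thesis by (intro exI[of _ 1] exI[of _ p]) auto
  next
    case True
    then obtain c where "\<forall>i. \<exists>q. p i = [:- c, 1:] * q"
      unfolding poly_eq_0_iff_dvd dvd_def by blast
    then obtain p' where p': "\<And>i. p i = [:- c, 1:] * p' i"
      by (auto simp: choice_iff)
    then have "p' j \<noteq> 0" using less.prems by auto
    moreover from this have "degree (p' j) < degree (p j)"
      unfolding p' by (subst degree_mult_eq) auto
    ultimately obtain g r where gr: "g \<noteq> 0" "\<And>i. p' i = g * r i" "\<And>c. \<exists>i. poly (r i) c \<noteq> 0"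
      using less.hyps by metis
    have "p i = ([:- c, 1:] * g) * r i" for i
      unfolding p' gr(2) by (rule mult.assoc[symmetric])
    moreover have "[:- c, 1:] * g \<noteq> 0"
      using gr(1) by (simp only: mult_eq_0_iff) simp
    ultimately show ?thesis
      using gr(3) by blast
  qed
qed

text \<open>With real coefficients, \<open>curve D (\<lambda>j. norm (b j))\<close> is the gauge of
  the curve with coefficients \<open>b\<close>. As only the coefficients up to \<open>D\<close>
  enter, limits of curves can be taken coefficientwise.\<close>

definition curve :: "nat \<Rightarrow> (nat \<Rightarrow> 'a) \<Rightarrow> real \<Rightarrow> 'a::real_vector" where
  "curve D b c = (\<Sum>j\<le>D. c ^ j *\<^sub>R b j)"

lemma curve_0 [simp]: "curve D b 0 = b 0"
  unfolding curve_def by (simp add: sum.atMost_shift)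

lemma curve_scale: "curve D (\<lambda>j. (s * t ^ j) *\<^sub>R b j) c = s *\<^sub>R curve D b (c * t)"
  unfolding curve_def by (simp add: scaleR_sum_right power_mult_distrib mult_ac)

lemma tendsto_curve:
  fixes b :: "nat \<Rightarrow> 'a::real_normed_vector"
  assumes "\<And>j. j \<le> D \<Longrightarrow> ((\<lambda>k. B k j) \<longlongrightarrow> b j) L" "(t \<longlongrightarrow> c) L"
  shows "((\<lambda>k. curve D (B k) (t k)) \<longlongrightarrow> curve D b c) L"
  unfolding curve_def using assms by (intro tendsto_intros) auto

lemma finite_curve_roots:
  fixes b :: "nat \<Rightarrow> real ^ 'q"
  assumes "curve D b c0 \<noteq> 0"
  shows "finite {c. curve D b c = 0}"
proof -
  obtain i where i: "curve D b c0 $ i \<noteq> 0"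
    using assms by (auto simp: vec_eq_iff)
  have eq: "curve D b c $ i = (\<Sum>j\<le>D. b j $ i * c ^ j)" for c
    by (simp add: curve_def mult.commute)
  have "\<exists>j\<le>D. b j $ i \<noteq> 0"
  proof (rule ccontr)
    assume "\<not> ?thesis"
    then show False using i unfolding eq by simp
  qed
  then have "finite {c. (\<Sum>j\<le>D. b j $ i * c ^ j) = 0}"
    by (simp add: polyfun_finite_roots)
  then show ?thesis by (rule finite_subset[rotated]) (auto simp flip: eq)
qed

lemma curve_coeff_eq_0:
  fixes b :: "nat \<Rightarrow> real ^ 'q"
  assumes "infinite {c. curve D b c = 0}" "j \<le> D"
  shows "b j = 0"
proof (rule ccontr)
  assume "b j \<noteq> 0"
  then obtain i where "b j $ i \<noteq> 0" by (auto simp: vec_eq_iff)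
  then have "finite {c. (\<Sum>j\<le>D. b j $ i * c ^ j) = 0}"
    using assms(2) by (auto simp: polyfun_finite_roots)
  moreover have "{c. curve D b c = 0} \<subseteq> {c. (\<Sum>j\<le>D. b j $ i * c ^ j) = 0}"
  proof clarify
    fix c assume "curve D b c = 0"
    then have "curve D b c $ i = 0" by simp
    then show "(\<Sum>j\<le>D. b j $ i * c ^ j) = 0" by (simp add: curve_def mult.commute)
  qed
  ultimately show False using assms(1) finite_subset by blast
qed

text \<open>Compactness of the normalized tuples makes \<open>\<delta>\<close> uniform: otherwise a
  nonzero limit tuple would have a curve vanishing on \<open>{2..3}\<close>. The interval starts at
  2 so that scales at least double; its end 3 bounds the jump.\<close>

lemma curve_lower_bound:
  "\<exists>\<delta>>0. \<delta> < 1 \<and> (\<forall>b :: nat \<Rightarrow> real ^ 'q. (\<Sum>j\<le>D. norm (b j)) = 1 \<longrightarrow>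
     (\<exists>c\<in>{2..3}. \<delta> * curve D (\<lambda>j. norm (b j)) c < norm (curve D b c)))"
proof (rule ccontr)
  assume neg: "\<not> ?thesis"
  have "\<exists>b :: nat \<Rightarrow> real ^ 'q. (\<Sum>j\<le>D. norm (b j)) = 1 \<and>
     (\<forall>c\<in>{2..3}. norm (curve D b c) \<le> inverse (Suc (Suc n)) * curve D (\<lambda>j. norm (b j)) c)" for n
  proof -
    \<comment> \<open>\<open>Suc (Suc n)\<close> instead of \<open>Suc n\<close> keeps the candidate
      for \<open>\<delta>\<close> strictly below 1.\<close>
    have "0 < inverse (real (Suc (Suc n)))" "inverse (real (Suc (Suc n))) < 1"
      by (auto simp: field_simps)
    with neg have "\<not> (\<forall>b :: nat \<Rightarrow> real ^ 'q. (\<Sum>j\<le>D. norm (b j)) = 1 \<longrightarrow>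
     (\<exists>c\<in>{2..3}. inverse (real (Suc (Suc n))) * curve D (\<lambda>j. norm (b j)) c < norm (curve D b c)))"
      by blast
    then show ?thesis
      by (simp only: not_all not_imp not_less bex_simps ball_simps not_ex)
  qed
  then obtain B :: "nat \<Rightarrow> nat \<Rightarrow> real ^ 'q" where B1: "\<And>n. (\<Sum>j\<le>D. norm (B n j)) = 1"
    and Bc: "\<And>n c. c \<in> {2..3} \<Longrightarrow>
      norm (curve D (B n) c) \<le> inverse (Suc (Suc n)) * curve D (\<lambda>j. norm (B n j)) c"
    by metis
  have "norm (B n j) \<le> 1" if "j \<le> D" for n j
    using member_le_sum[of j "{..D}" "\<lambda>j. norm (B n j)"] that B1 by auto
  then have "bounded (range (\<lambda>n. B n j))" if "j \<le> D" for j
    using that by (auto simp: bounded_iff)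
  then obtain s b where s: "strict_mono s" and b: "\<And>j. j \<le> D \<Longrightarrow> (\<lambda>k. B (s k) j) \<longlonglongrightarrow> b j"
    using common_convergent_subsequence[of D B] by blast
  have "curve D b c = 0" if c: "c \<in> {2..3}" for c
  proof -
    have "(\<lambda>n. inverse (real (Suc n))) \<longlonglongrightarrow> 0" by (rule LIMSEQ_inverse_real_of_nat)
    from LIMSEQ_subseq_LIMSEQ[OF LIMSEQ_Suc[OF this] s]
    have "(\<lambda>n. inverse (real (Suc (Suc (s n))))) \<longlonglongrightarrow> 0" by (simp add: o_def)
    moreover have "(\<lambda>n. curve D (\<lambda>j. norm (B (s n) j)) c) \<longlonglongrightarrow> curve D (\<lambda>j. norm (b j)) c"
      by (intro tendsto_curve tendsto_norm b) auto
    ultimately have "(\<lambda>n. inverse (real (Suc (Suc (s n)))) * curve D (\<lambda>j. norm (B (s n) j)) c) \<longlonglongrightarrow> 0"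
      using tendsto_mult by force
    moreover have "(\<lambda>n. norm (curve D (B (s n)) c)) \<longlonglongrightarrow> norm (curve D b c)"
      by (intro tendsto_curve tendsto_norm b) auto
    ultimately have "norm (curve D b c) \<le> 0"
      using Bc[OF c] by (intro LIMSEQ_le) blast+
    then show ?thesis by simp
  qed
  then have "{2..3} \<subseteq> {c. curve D b c = 0}" by auto
  then have "infinite {c. curve D b c = 0}"
    by (rule infinite_super) simp
  then have "(\<Sum>j\<le>D. norm (b j)) = 0"
    using curve_coeff_eq_0[of D b] by simp
  moreover have "(\<lambda>k. \<Sum>j\<le>D. norm (B (s k) j)) \<longlonglongrightarrow> (\<Sum>j\<le>D. norm (b j))"
    by (intro tendsto_intros b) auto
  ultimately show False using B1 LIMSEQ_unique[OF tendsto_const] by force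
qed

text \<open>After removal of the common factor of its coordinates, a polynomial curve has a continuous
  direction, even across its zeros.\<close>

lemma curve_direction_same_side:
  fixes b :: "nat \<Rightarrow> real ^ 'q"
  assumes cl: "closed A" "closed B" and disj: "A \<inter> B = {}"
    and sym: "\<And>u. u \<in> A \<Longrightarrow> - u \<in> A" "\<And>u. u \<in> B \<Longrightarrow> - u \<in> B"
    and cover: "\<And>c. c \<in> {0..3} \<Longrightarrow> curve D b c \<noteq> 0 \<Longrightarrow> sgn (curve D b c) \<in> A \<union> B"
    and c1: "c1 \<in> {0..3}" "curve D b c1 \<noteq> 0" "sgn (curve D b c1) \<in> A"
    and c2: "c2 \<in> {0..3}" "curve D b c2 \<noteq> 0"
  shows "sgn (curve D b c2) \<in> A"
proof -
  define p where "p i = (\<Sum>j\<le>D. monom (b j $ i) j)" for i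
  have p: "poly (p i) c = curve D b c $ i" for i c
    by (simp add: p_def curve_def poly_sum poly_monom mult.commute)
  obtain i where "curve D b c1 $ i \<noteq> 0"
    using c1(2) by (auto simp: vec_eq_iff)
  then have "p i \<noteq> 0" using p by (metis poly_0)
  then obtain g r where gr: "g \<noteq> 0" "\<And>i. p i = g * r i" "\<And>c. \<exists>i. poly (r i) c \<noteq> 0"
    using poly_family_common_factor[of p i] by blast
  define R where "R c = (\<chi> i. poly (r i) c)" for c
  have R0: "R c \<noteq> 0" for c
    using gr(3)[of c] by (auto simp: R_def vec_eq_iff)
  have cR: "continuous_on S (\<lambda>c. sgn (R c))" for S
    unfolding sgn_div_norm using R0
    by (intro continuous_intros) (auto simp: R_def intro!: continuous_intros)
  have q: "curve D b c = poly g c *\<^sub>R R c" for c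
    by (simp add: vec_eq_iff R_def gr(2) flip: p)
  have sg: "sgn (curve D b c) = sgn (poly g c) *\<^sub>R sgn (R c)" for c
    by (simp add: q sgn_scaleR)
  \<comment> \<open>Off its zeros, the curve has the direction of \<open>R\<close> up to the sign of
    \<open>poly g c\<close>, which symmetric sets do not detect.\<close>
  have side: "sgn (R c) \<in> X \<longleftrightarrow> sgn (curve D b c) \<in> X"
    if "curve D b c \<noteq> 0" "\<And>u. u \<in> X \<Longrightarrow> - u \<in> X" for c X
  proof -
    have "poly g c \<noteq> 0" using that(1) q by auto
    then show ?thesis unfolding sg using that(2)[of "sgn (R c)"] that(2)[of "- sgn (R c)"]
      by (auto simp: sgn_real_def)
  qed
  \<comment> \<open>Every parameter, even a zero of the curve, is a limit of parameters with nonzero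
    value, and \<open>A \<union> B\<close> is closed.\<close>
  have dense: "sgn (R c) \<in> A \<union> B" if c: "c \<in> {0..3}" for c
  proof -
    let ?W = "{c \<in> {0..3}. sgn (R c) \<in> A \<union> B}"
    have "c islimpt ({0..3} - {c. curve D b c = 0})"
      using c finite_curve_roots[OF c1(2)]
      by (intro islimpt_Diff_finite islimpt_atLeastAtMost) auto
    then have "c islimpt ?W"
    proof (rule islimpt_subset)
      show "{0..3} - {c. curve D b c = 0} \<subseteq> ?W"
        using side[of _ "A \<union> B"] cover sym by blast
    qed
    moreover have "closed ?W"
      using continuous_closed_preimage[OF cR closed_atLeastAtMost closed_Un[OF cl], of 0 3]
      by (simp add: vimage_def Int_def)
    ultimately show ?thesis
      using closed_limpt by blast
  qed
  have "connected ((\<lambda>c. sgn (R c)) ` {0..3})"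
    using cR by (intro connected_continuous_image) auto
  moreover have "(\<lambda>c. sgn (R c)) ` {0..3} \<subseteq> A \<union> B" "A \<inter> B \<inter> (\<lambda>c. sgn (R c)) ` {0..3} = {}"
    using disj dense by blast+
  ultimately have "A \<inter> (\<lambda>c. sgn (R c)) ` {0..3} = {} \<or> B \<inter> (\<lambda>c. sgn (R c)) ` {0..3} = {}"
    using connected_closedD cl by blast
  moreover have "sgn (R c1) \<in> A" using side[of c1 A] c1 sym by blast
  ultimately have "sgn (R c2) \<in> A"
    using dense[OF c2(1)] c1(1) c2(1) by blast
  then show ?thesis using side[of c2 A] c2 sym by blast
qed


subsection \<open>Limits of directions\<close>

text \<open>In the application \<open>F\<close> is the tuple of homogenized polynomials,
  \<open>h\<close> the coordinate \<open>x\<^sub>0\<close> and \<open>z\<close> the index of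
  \<open>F\<^sub>0\<close>. The cases of \<open>dichotomy\<close> are that \<open>F\<^sub>0'\<close>
  does not vanish at \<open>P\<close> and that \<open>P\<close> is a point of regularity;
  \<open>\<gamma>\<close> is complex because regularity is that of the complex rational map.\<close>

locale asymptotic_directions =
  fixes F :: "'a::euclidean_space \<Rightarrow> real ^ 'q::finite" and h :: "'a \<Rightarrow> real" and z :: 'q and d :: nat
  assumes contF: "continuous_on UNIV F"
    and lin: "bounded_linear h" and h_nonzero: "\<exists>e. h e \<noteq> 0"
    and homogeneous: "F (c *\<^sub>R x) = c ^ d *\<^sub>R F x"
    and expand: "\<exists>D C. (\<forall>j. continuous_on UNIV (C j)) \<and> (\<forall>x t. F (x + t *\<^sub>R v) = curve D (\<lambda>j. C j x) t)"
    and finite_part: "h x \<noteq> 0 \<Longrightarrow> F x $ z \<noteq> 0"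
    and infinite_part: "h x = 0 \<Longrightarrow> F x $ z = 0"
    and nontrivial: "\<exists>w. h w = 0 \<and> F w \<noteq> 0"
    and dichotomy: "h P = 0 \<Longrightarrow> norm P = 1 \<Longrightarrow>
      (\<exists>r>0. \<exists>M. \<forall>x\<in>ball P r. \<forall>y\<in>ball P r. h x = h y \<longrightarrow> \<bar>F x $ z\<bar> \<le> M * \<bar>F y $ z\<bar>) \<or>
      (\<exists>\<gamma> :: 'a \<Rightarrow> complex ^ 'q. isCont \<gamma> P \<and> \<gamma> P \<noteq> 0 \<and>
        (\<forall>x i j. complex_of_real (F x $ i) * \<gamma> x $ j = complex_of_real (F x $ j) * \<gamma> x $ i))"
begin

definition dirs :: "(real ^ 'q) set" where
  "dirs = (\<lambda>x. sgn (F x)) ` {x. h x \<noteq> 0}"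

text \<open>The lift of the points at infinity to the unit sphere; both signs occur because a
  projective point has two unit representatives.\<close>

definition limits :: "(real ^ 'q) set" where
  "limits = {u. u $ z = 0 \<and> (u \<in> closure dirs \<or> - u \<in> closure dirs)}"

lemma limitsI:
  assumes "\<And>k. h (x k) \<noteq> 0" "(\<lambda>k. sgn (F (x k))) \<longlonglongrightarrow> u" "u $ z = 0"
  shows "u \<in> limits"
proof -
  have "u \<in> closure dirs"
    unfolding closure_sequential using assms(1,2)
    by (intro exI[of _ "\<lambda>k. sgn (F (x k))"]) (auto simp: dirs_def)
  then show ?thesis using assms(3) by (simp add: limits_def)
qed

lemma F_nonzero: "h x \<noteq> 0 \<Longrightarrow> F x \<noteq> 0"
  using finite_part[of x] by auto

lemma dirs_subset_sphere: "closure dirs \<subseteq> sphere 0 1"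
  by (intro closure_minimal) (auto simp: dirs_def norm_sgn F_nonzero)

lemma norm_limits: "u \<in> limits \<Longrightarrow> norm u = 1"
  using dirs_subset_sphere by (auto simp: limits_def)

lemma closed_limits: "closed limits"
proof -
  have "closed {u :: real ^ 'q. u $ z = 0}"
    by (intro closed_Collect_eq continuous_intros)
  moreover have "closed (closure dirs \<union> uminus ` closure dirs)"
    by (intro closed_Un closed_negations) auto
  moreover have "limits = {u. u $ z = 0} \<inter> (closure dirs \<union> uminus ` closure dirs)"
    by (force simp: limits_def image_iff)
  ultimately show ?thesis by (simp add: closed_Int)
qed

lemma limits_uminus: "u \<in> limits \<Longrightarrow> - u \<in> limits"
  by (auto simp: limits_def)

lemma isCont_F: "isCont F x"
  using contF by (simp add: continuous_on_eq_continuous_at)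

lemma sgn_F_infinity:
  assumes "h w = 0" "F w \<noteq> 0"
  shows "sgn (F w) \<in> limits"
proof -
  interpret h: bounded_linear h by (rule lin)
  obtain e where e: "h e \<noteq> 0" using h_nonzero by blast
  have "(\<lambda>k. w + inverse (real (Suc k)) *\<^sub>R e) \<longlonglongrightarrow> w + 0 *\<^sub>R e"
    by (intro tendsto_intros LIMSEQ_inverse_real_of_nat)
  then have "(\<lambda>k. sgn (F (w + inverse (real (Suc k)) *\<^sub>R e))) \<longlonglongrightarrow> sgn (F w)"
    using assms(2) isCont_F by (intro tendsto_sgn isCont_tendsto_compose[of w F]) auto
  moreover have "h (w + inverse (real (Suc k)) *\<^sub>R e) \<noteq> 0" for k
    using e assms(1) by (simp add: h.add h.scaleR)
  moreover have "sgn (F w) $ z = 0"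
    using infinite_part[OF assms(1)] by (simp add: sgn_div_norm)
  ultimately show ?thesis by (intro limitsI)
qed

end

section \<open>A hypothetical separation of the limit directions\<close>

locale separated_asymptotic_directions = asymptotic_directions F h z d
  for F :: "'a::euclidean_space \<Rightarrow> real ^ 'q::finite" and h z d +
  fixes A B :: "(real ^ 'q) set"
  assumes clA: "closed A" and clB: "closed B" and disj: "A \<inter> B = {}" and cover: "A \<union> B = limits"
    and symA: "u \<in> A \<Longrightarrow> - u \<in> A" and symB: "u \<in> B \<Longrightarrow> - u \<in> B"
begin

text \<open>The line through \<open>w\<close> and \<open>w'\<close> stays in \<open>h = 0\<close>,
  so \<open>F\<close> restricted to it is a polynomial curve whose nonzero values all have
  directions in \<open>limits\<close>; such a curve cannot change sides.\<close>

lemma infinity_same_side: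
  assumes "h w = 0" "F w \<noteq> 0" "sgn (F w) \<in> A" and "h w' = 0" "F w' \<noteq> 0"
  shows "sgn (F w') \<in> A"
proof -
  interpret h: bounded_linear h by (rule lin)
  obtain D C where C: "\<And>x t. F (x + t *\<^sub>R (w' - w)) = curve D (\<lambda>j. C j x) t"
    using expand[of "w' - w"] by blast
  let ?q = "curve D (\<lambda>j. C j w)"
  have 0: "?q 0 = F w" and 1: "?q 1 = F w'"
    using C[of w 0] C[of w 1] by auto
  have "sgn (?q 1) \<in> A"
  proof (rule curve_direction_same_side[OF clA clB disj symA symB, where ?c1.0 = 0])
    fix c :: real assume "?q c \<noteq> 0"
    then show "sgn (?q c) \<in> A \<union> B"
      unfolding cover C[symmetric] using assms by (intro sgn_F_infinity) (auto simp: h.add h.scaleR h.diff)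
  qed (use assms 0 1 in auto)
  then show ?thesis by (simp only: 1)
qed

end

text \<open>\<open>F x\<close> is parallel to \<open>\<gamma> x\<close>, so every limit direction at
  \<open>P\<close> lies on the complex line spanned by \<open>\<gamma> P\<close>, which contains at
  most two real unit vectors, opposite to each other.\<close>

lemma (in asymptotic_directions) regular_limits_agree:
  fixes \<gamma> :: "'a \<Rightarrow> complex ^ 'q"
  assumes \<gamma>: "isCont \<gamma> P" "\<gamma> P \<noteq> 0"
      "\<And>x i j. complex_of_real (F x $ i) * \<gamma> x $ j = complex_of_real (F x $ j) * \<gamma> x $ i"
    and x: "x \<longlonglongrightarrow> P" "(\<lambda>k. sgn (F (x k))) \<longlonglongrightarrow> u" and u: "norm u = 1"
    and y: "y \<longlonglongrightarrow> P" "(\<lambda>k. sgn (F (y k))) \<longlonglongrightarrow> u'" and u': "norm u' = 1"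
  shows "u' = u \<or> u' = - u"
proof -
  have par: "complex_of_real (u $ i) * \<gamma> P $ j = complex_of_real (u $ j) * \<gamma> P $ i"
    if x: "x \<longlonglongrightarrow> P" "(\<lambda>k. sgn (F (x k))) \<longlonglongrightarrow> u" for x u i j
  proof -
    have g: "(\<lambda>k. \<gamma> (x k)) \<longlonglongrightarrow> \<gamma> P"
      using \<gamma>(1) x(1) by (rule isCont_tendsto_compose)
    have lim: "(\<lambda>k. complex_of_real (sgn (F (x k)) $ i) * \<gamma> (x k) $ j)
        \<longlonglongrightarrow> complex_of_real (u $ i) * \<gamma> P $ j" for i j
      by (intro tendsto_intros g x)
    have "complex_of_real (sgn (F (x k)) $ i) * \<gamma> (x k) $ j =
        complex_of_real (sgn (F (x k)) $ j) * \<gamma> (x k) $ i" for k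
      using \<gamma>(3)[of "x k" i j] by (simp add: sgn_div_norm)
    then show ?thesis
      using lim[of i j] lim[of j i] by (simp add: LIMSEQ_unique)
  qed
  obtain j where j: "\<gamma> P $ j \<noteq> 0"
    using \<gamma>(2) by (auto simp: vec_eq_iff)
  have nz: "u $ j \<noteq> 0"
  proof
    assume "u $ j = 0"
    then have "u = 0" using par[OF x, of _ j] j by (simp add: vec_eq_iff)
    then show False using u by simp
  qed
  have cross: "u' $ i * u $ j = u $ i * u' $ j" for i
  proof -
    have "complex_of_real (u' $ i * u $ j) * \<gamma> P $ j = complex_of_real (u $ j) * (complex_of_real (u' $ i) * \<gamma> P $ j)"
      by simp
    also have "\<dots> = complex_of_real (u' $ j) * (complex_of_real (u $ j) * \<gamma> P $ i)"
      by (simp add: par[OF y, of i j])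
    also have "\<dots> = complex_of_real (u $ i * u' $ j) * \<gamma> P $ j"
      by (simp flip: par[OF x, of i j])
    finally have "complex_of_real (u' $ i * u $ j) * \<gamma> P $ j = complex_of_real (u $ i * u' $ j) * \<gamma> P $ j" .
    then have "complex_of_real (u' $ i * u $ j) = complex_of_real (u $ i * u' $ j)"
      using j by (rule mult_right_cancel[THEN iffD1, rotated])
    then show ?thesis by (simp only: of_real_eq_iff)
  qed
  define t where "t = u' $ j / u $ j"
  have "u' $ i = t * u $ i" for i
  proof -
    have "t * u $ i = u $ i * u' $ j / u $ j" by (simp add: t_def)
    then show ?thesis using nz by (simp flip: cross)
  qed
  then have eq: "u' = t *\<^sub>R u"
    by (simp add: vec_eq_iff)
  then have "\<bar>t\<bar> = 1" using u u' by simp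
  then have "t = 1 \<or> t = - 1" by linarith
  then show ?thesis using eq by auto
qed

context separated_asymptotic_directions
begin

lemma compactA: "compact A" and compactB: "compact B"
proof -
  have "A \<subseteq> cball 0 1" "B \<subseteq> cball 0 1"
    using cover norm_limits by force+
  then show "compact A" "compact B"
    using clA clB by (auto simp: compact_eq_bounded_closed intro: bounded_subset[OF bounded_cball])
qed

lemma infdist_far:
  assumes "A \<noteq> {}" "\<And>u u'. u \<in> A \<Longrightarrow> u' \<in> B \<Longrightarrow> 2 * \<rho> \<le> dist u u'" "u \<in> B"
  shows "2 * \<rho> \<le> infdist u A"
  using infdist_attains_inf[OF clA assms(1), of u] assms(2,3) by (metis dist_commute)

text \<open>The rescaled curves \<open>c \<mapsto> F (x k + c l k v)\<close> subconverge, after normalization, to a polynomial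
  curve whose directions are all limits.  Its direction at \<open>1\<close> lies in \<open>A\<close>, hence so does its
  direction at some \<open>c \<ge> 2\<close> where the curve is not small.\<close>

lemma doubling:
  assumes exp: "\<And>x t. F (x + t *\<^sub>R v) = curve D (\<lambda>j. C j x) t"
    and v: "h v = 0"
    and \<delta>: "0 < \<delta>" "\<And>b :: nat \<Rightarrow> real ^ 'q. (\<Sum>j\<le>D. norm (b j)) = 1 \<Longrightarrow>
      \<exists>c\<in>{2..3}. \<delta> * curve D (\<lambda>j. norm (b j)) c < norm (curve D b c)"
    and A: "A \<noteq> {}"
    and \<rho>: "0 < \<rho>" "\<And>u u'. u \<in> A \<Longrightarrow> u' \<in> B \<Longrightarrow> 2 * \<rho> \<le> dist u u'"
    and bnd: "\<And>k t. 0 \<le> t \<Longrightarrow> t \<le> \<epsilon> \<Longrightarrow> \<bar>F (x k + t *\<^sub>R v) $ z\<bar> \<le> M * \<bar>F (x k) $ z\<bar>"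
    and x: "\<And>k. h (x k) \<noteq> 0" "(\<lambda>k. sgn (F (x k)) $ z) \<longlonglongrightarrow> 0"
    and l: "\<And>k. 0 < l k" "\<And>k. 3 * l k \<le> \<epsilon>"
    and large: "\<And>k. \<delta> * curve D (\<lambda>j. norm (C j (x k))) (l k) \<le> norm (F (x k + l k *\<^sub>R v))"
    and near: "\<And>k. infdist (sgn (F (x k + l k *\<^sub>R v))) A < \<rho>"
  shows "\<exists>k l'. 2 * l k \<le> l' \<and> l' \<le> \<epsilon> \<and>
    \<delta> * curve D (\<lambda>j. norm (C j (x k))) l' \<le> norm (F (x k + l' *\<^sub>R v)) \<and>
    infdist (sgn (F (x k + l' *\<^sub>R v))) A < \<rho>"
proof -
  interpret h: bounded_linear h by (rule lin)
  \<comment> \<open>Division by the gauge at scale \<open>l k\<close> makes the norms of the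
    rescaled coefficients sum to 1, so a subsequence converges coefficientwise to a nonzero
    tuple.\<close>
  define N where "N k = curve D (\<lambda>j. norm (C j (x k))) (l k)" for k
  define B' where "B' k j = (1 / N k * l k ^ j) *\<^sub>R C j (x k)" for k j
  have Fx: "F (x k) = C 0 (x k)" for k using exp[of "x k" 0] by simp
  have NF: "norm (F (x k)) \<le> N k" for k
  proof -
    have "(\<Sum>j\<in>{0}. l k ^ j *\<^sub>R norm (C j (x k))) \<le> N k"
      unfolding N_def curve_def using l(1)[of k] by (intro sum_mono2) auto
    then show ?thesis by (simp add: Fx)
  qed
  have Fpos: "0 < norm (F (x k))" for k using F_nonzero[OF x(1)] by simp
  have Npos: "0 < N k" for k using Fpos[of k] NF[of k] by linarith
  have cB: "curve D (B' k) c = (1 / N k) *\<^sub>R F (x k + (c * l k) *\<^sub>R v)" for k c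
    unfolding B'_def curve_scale exp ..
  have "norm (B' k j) = (1 / N k * l k ^ j) *\<^sub>R norm (C j (x k))" for k j
    using Npos[of k] l(1)[of k] by (simp add: B'_def)
  then have cN: "curve D (\<lambda>j. norm (B' k j)) c = (1 / N k) * curve D (\<lambda>j. norm (C j (x k))) (c * l k)" for k c
    by (simp only: curve_scale) simp
  have sum1: "(\<Sum>j\<le>D. norm (B' k j)) = 1" for k
    using cN[of k 1] Npos[of k] by (simp add: curve_def N_def)
  have "norm (B' k j) \<le> 1" if "j \<le> D" for k j
    using member_le_sum[of j "{..D}" "\<lambda>j. norm (B' k j)"] that sum1 by auto
  then have "bounded (range (\<lambda>k. B' k j))" if "j \<le> D" for j
    using that by (auto simp: bounded_iff)
  then obtain s b where s: "strict_mono s" and b: "\<And>j. j \<le> D \<Longrightarrow> (\<lambda>k. B' (s k) j) \<longlonglongrightarrow> b j"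
    using common_convergent_subsequence[of D B'] by blast
  have "(\<lambda>k. \<Sum>j\<le>D. norm (B' (s k) j)) \<longlonglongrightarrow> (\<Sum>j\<le>D. norm (b j))"
    by (intro tendsto_intros b) auto
  then have b1: "(\<Sum>j\<le>D. norm (b j)) = 1"
    by (simp add: sum1 LIMSEQ_const_iff)
  have lim: "(\<lambda>k. curve D (B' (s k)) c) \<longlonglongrightarrow> curve D b c" for c
    by (intro tendsto_curve b) auto
  \<comment> \<open>Up to parameter 3 the scale stays below \<open>\<epsilon>\<close>, so
    \<open>bnd\<close> applies. As \<open>N k\<close> dominates the norm of \<open>F (x k)\<close>,
    the rescaled component is at most a multiple of \<open>sgn (F (x k)) $ z\<close>, which tends to
    0.\<close>
  have qz: "curve D b c $ z = 0" if c: "c \<in> {0..3}" for c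
  proof -
    have le: "\<bar>curve D (B' k) c $ z\<bar> \<le> \<bar>M\<bar> * \<bar>sgn (F (x k)) $ z\<bar>" for k
    proof -
      have "c * l k \<le> 3 * l k"
        using c l(1)[of k] by (intro mult_right_mono) auto
      moreover have "0 \<le> c * l k"
        using c l(1)[of k] by auto
      moreover note l(2)[of k]
      ultimately have "c * l k \<le> \<epsilon>" "0 \<le> c * l k"
        by linarith+
      then have "\<bar>F (x k + (c * l k) *\<^sub>R v) $ z\<bar> \<le> M * \<bar>F (x k) $ z\<bar>"
        by (intro bnd)
      also have "\<dots> \<le> \<bar>M\<bar> * \<bar>F (x k) $ z\<bar>" by (intro mult_right_mono) auto
      finally have "\<bar>curve D (B' k) c $ z\<bar> \<le> \<bar>M\<bar> * \<bar>F (x k) $ z\<bar> / N k"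
        using Npos[of k] by (simp add: cB abs_mult divide_right_mono)
      also have "\<dots> \<le> \<bar>M\<bar> * \<bar>F (x k) $ z\<bar> / norm (F (x k))"
        using NF[of k] Fpos[of k] Npos[of k] by (intro divide_left_mono) auto
      also have "\<dots> = \<bar>M\<bar> * \<bar>sgn (F (x k)) $ z\<bar>"
        by (simp add: sgn_div_norm abs_mult divide_inverse)
      finally show ?thesis .
    qed
    have "(\<lambda>k. \<bar>M\<bar> * \<bar>sgn (F (x (s k))) $ z\<bar>) \<longlonglongrightarrow> 0"
      using LIMSEQ_subseq_LIMSEQ[OF x(2) s] unfolding o_def
      by (intro tendsto_mult_right_zero tendsto_rabs_zero)
    then have "(\<lambda>k. curve D (B' (s k)) c $ z) \<longlonglongrightarrow> 0"
      by (rule Lim_null_comparison[rotated]) (simp add: le)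
    moreover have "(\<lambda>k. curve D (B' (s k)) c $ z) \<longlonglongrightarrow> curve D b c $ z"
      by (intro tendsto_vec_nth lim)
    ultimately show ?thesis using LIMSEQ_unique by blast
  qed
  have sgnB: "sgn (curve D (B' k) c) = sgn (F (x k + (c * l k) *\<^sub>R v))" for k c
    using Npos[of k] by (simp add: cB sgn_scaleR)
  have sgnlim: "(\<lambda>k. sgn (F (x (s k) + (c * l (s k)) *\<^sub>R v))) \<longlonglongrightarrow> sgn (curve D b c)"
    if "curve D b c \<noteq> 0" for c
    using tendsto_sgn[OF lim that] by (simp add: sgnB)
  have qlim: "sgn (curve D b c) \<in> limits" if "c \<in> {0..3}" "curve D b c \<noteq> 0" for c
  proof (rule limitsI[OF _ sgnlim[OF that(2)]])
    show "h (x (s k) + (c * l (s k)) *\<^sub>R v) \<noteq> 0" for k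
      using x(1) v by (simp add: h.add h.scaleR)
    show "sgn (curve D b c) $ z = 0" using qz[OF that(1)] by (simp add: sgn_div_norm)
  qed
  \<comment> \<open>Divided by \<open>N k\<close>, the bound \<open>large\<close> survives in the
    limit, so the limit curve has a direction at 1.\<close>
  have "\<delta> \<le> norm (curve D b 1)"
  proof (rule LIMSEQ_le_const[OF tendsto_norm[OF lim]], intro exI[of _ 0] allI impI)
    fix k
    show "\<delta> \<le> norm (curve D (B' (s k)) 1)"
      using large[of "s k"] Npos[of "s k"] by (simp add: cB field_simps flip: N_def)
  qed
  then have q1: "curve D b 1 \<noteq> 0" using \<delta>(1) by auto
  have "infdist (sgn (curve D b 1)) A \<le> \<rho>"
  proof (rule LIMSEQ_le_const2[OF tendsto_infdist[OF sgnlim[OF q1]]], intro exI[of _ 0] allI impI)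
    fix k
    show "infdist (sgn (F (x (s k) + (1 * l (s k)) *\<^sub>R v))) A \<le> \<rho>"
      using near[of "s k"] by simp
  qed
  then have "sgn (curve D b 1) \<notin> B"
    using infdist_far[OF A \<rho>(2)] \<rho>(1) by fastforce
  then have q1A: "sgn (curve D b 1) \<in> A"
    using qlim[of 1] q1 cover by auto
  \<comment> \<open>At this \<open>c\<close> the limit curve satisfies the \<open>\<delta>\<close>
    inequality strictly; strictness carries it back to some index of the sequence.\<close>
  obtain c where c: "c \<in> {2..3}" "\<delta> * curve D (\<lambda>j. norm (b j)) c < norm (curve D b c)"
    using \<delta>(2)[OF b1] by blast
  have "0 \<le> curve D (\<lambda>j. norm (b j)) c"
    using c(1) unfolding curve_def by (intro sum_nonneg) auto
  then have qc: "curve D b c \<noteq> 0"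
    using c(2) \<delta>(1) by (metis mult_nonneg_nonneg less_imp_le norm_zero not_less)
  have "sgn (curve D b c) \<in> A"
    by (rule curve_direction_same_side[OF clA clB disj symA symB, where ?c1.0 = 1])
      (use qlim cover c(1) q1 q1A qc in auto)
  then have "infdist (sgn (curve D b c)) A < \<rho>" using \<rho>(1) by simp
  then have ev1: "\<forall>\<^sub>F k in sequentially. infdist (sgn (F (x (s k) + (c * l (s k)) *\<^sub>R v))) A < \<rho>"
    by (rule order_tendstoD(2)[OF tendsto_infdist[OF sgnlim[OF qc]]])
  have "(\<lambda>k. norm (curve D (B' (s k)) c) - \<delta> * curve D (\<lambda>j. norm (B' (s k) j)) c)
      \<longlonglongrightarrow> norm (curve D b c) - \<delta> * curve D (\<lambda>j. norm (b j)) c"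
    by (intro tendsto_intros tendsto_curve b) auto
  then have ev2: "\<forall>\<^sub>F k in sequentially.
      0 < norm (curve D (B' (s k)) c) - \<delta> * curve D (\<lambda>j. norm (B' (s k) j)) c"
    by (rule order_tendstoD(1)) (use c(2) in auto)
  from eventually_conj[OF ev1 ev2] obtain k where
    k: "infdist (sgn (F (x (s k) + (c * l (s k)) *\<^sub>R v))) A < \<rho>"
      "\<delta> * curve D (\<lambda>j. norm (B' (s k) j)) c < norm (curve D (B' (s k)) c)"
    by (auto simp: eventually_sequentially)
  have "\<delta> * curve D (\<lambda>j. norm (C j (x (s k)))) (c * l (s k)) < norm (F (x (s k) + (c * l (s k)) *\<^sub>R v))"
    using k(2) Npos[of "s k"] unfolding cN cB by (simp add: field_simps)
  moreover have "2 * l (s k) \<le> c * l (s k)"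
    using c(1) l(1)[of "s k"] by (intro mult_right_mono) auto
  moreover have "c * l (s k) \<le> \<epsilon>"
  proof (rule order_trans[OF _ l(2)])
    show "c * l (s k) \<le> 3 * l (s k)"
      using c(1) l(1)[of "s k"] by (intro mult_right_mono) auto
  qed
  ultimately show ?thesis
    using k(1) by (intro exI[of _ "s k"] exI[of _ "c * l (s k)"] conjI less_imp_le[of "\<delta> * _"])
qed

end

section \<open>From small scales to a fixed scale\<close>

text \<open>Were every element at most \<open>\<epsilon> / 3\<close>, an element beyond half the
  supremum would have a partner at least twice as large, hence beyond the supremum.\<close>

lemma doubling_reaches_end:
  fixes T :: "real set"
  assumes "T \<noteq> {}" "T \<subseteq> {0<..\<epsilon>}" "\<And>l. l \<in> T \<Longrightarrow> 3 * l \<le> \<epsilon> \<Longrightarrow> \<exists>l'\<in>T. 2 * l \<le> l'"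
  shows "\<exists>l\<in>T. \<epsilon> < 3 * l"
proof (rule ccontr)
  assume neg: "\<not> ?thesis"
  have bdd: "bdd_above T" using assms(2) by (intro bdd_aboveI[of T \<epsilon>]) auto
  obtain l0 where "l0 \<in> T" using assms(1) by blast
  then have pos: "0 < Sup T" using cSup_upper[OF _ bdd, of l0] assms(2) by force
  then obtain l where l: "l \<in> T" "Sup T / 2 < l"
    using less_cSupD[OF assms(1), of "Sup T / 2"] by auto
  moreover obtain l' where "l' \<in> T" "2 * l \<le> l'"
    using assms(3)[OF l(1)] neg l(1) by force
  ultimately show False using cSup_upper[OF _ bdd, of l'] by linarith
qed

context separated_asymptotic_directions
begin

text \<open>A member of \<open>A\<close> would be, up to sign, a limit of directions at affine
  points tending to some \<open>P\<close> at infinity. Along the line from \<open>P\<close> to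
  \<open>w\<close> all directions lie in \<open>B\<close>. In the regular case they have, near
  \<open>P\<close>, the same limit up to sign; otherwise \<open>doubling\<close> leads to one of
  them that is close to \<open>A\<close>.\<close>

lemma no_dirs_opposite_infinity:
  assumes A: "A \<noteq> {}" and w: "h w = 0" "F w \<noteq> 0" "sgn (F w) \<in> B"
  shows False
proof -
  interpret h: bounded_linear h by (rule lin)
  \<comment> \<open>A direction at infinity in \<open>A\<close> would force that of
    \<open>F w\<close> into \<open>A\<close> as well.\<close>
  have EB: "sgn (F y) \<in> B" if "h y = 0" "F y \<noteq> 0" for y
    using sgn_F_infinity[OF that] infinity_same_side[OF that _ w(1,2)] w(3) cover disj by blast
  obtain a where a: "a \<in> A" "a \<in> closure dirs"
    using A cover symA unfolding limits_def by blast
  have az: "a $ z = 0" "norm a = 1"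
    using a(1) cover norm_limits by (auto simp: limits_def)
  obtain u where u: "\<And>k. u k \<in> dirs" "u \<longlonglongrightarrow> a"
    using a(2) unfolding closure_sequential by blast
  \<comment> \<open>Replacing \<open>y\<close> by \<open>sgn y\<close> multiplies \<open>F y\<close>
    by a positive factor, so the base points can be taken in the compact unit sphere.\<close>
  have "\<exists>x. norm x = 1 \<and> h x \<noteq> 0 \<and> u k = sgn (F x)" for k
  proof -
    obtain y where y: "h y \<noteq> 0" "u k = sgn (F y)"
      using u(1)[of k] by (auto simp: dirs_def)
    then have "y \<noteq> 0" by auto
    then show ?thesis
      using y by (intro exI[of _ "sgn y"]) (simp add: norm_sgn sgn_div_norm[of y] homogeneous sgn_scaleR h.scaleR)
  qed
  then obtain x0 where x0: "\<And>k. norm (x0 k) = 1" "\<And>k. h (x0 k) \<noteq> 0" "\<And>k. u k = sgn (F (x0 k))"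
    by metis
  obtain P s where s: "strict_mono s" "(x0 \<circ> s) \<longlonglongrightarrow> P"
    using compact_sphere[of "0 :: 'a" 1] x0(1) unfolding compact_def by (metis mem_sphere_0)
  define x where "x = x0 \<circ> s"
  have x: "\<And>k. norm (x k) = 1" "\<And>k. h (x k) \<noteq> 0" "x \<longlonglongrightarrow> P" "(\<lambda>k. sgn (F (x k))) \<longlonglongrightarrow> a"
    using x0 s LIMSEQ_subseq_LIMSEQ[OF u(2) s(1)] by (auto simp: x_def o_def)
  have nP: "norm P = 1"
    using tendsto_norm[OF x(3)] by (simp add: x(1) LIMSEQ_const_iff)
  have FxP: "(\<lambda>k. F (x k)) \<longlonglongrightarrow> F P"
    by (rule isCont_tendsto_compose[OF isCont_F x(3)])
  \<comment> \<open>If \<open>P\<close> were affine, \<open>a\<close> would be the direction of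
    \<open>F P\<close>, whose component \<open>z\<close> is nonzero.\<close>
  have hP: "h P = 0"
  proof (rule ccontr)
    assume nz: "h P \<noteq> 0"
    then have "(\<lambda>k. sgn (F (x k))) \<longlonglongrightarrow> sgn (F P)"
      by (intro tendsto_sgn FxP F_nonzero)
    then have "sgn (F P) = a" using x(4) LIMSEQ_unique by blast
    then show False using az(1) finite_part[OF nz] F_nonzero[OF nz] by (auto simp: sgn_div_norm)
  qed
  \<comment> \<open>The line from \<open>P\<close> reaches \<open>w\<close> at parameter 1, so
    \<open>F\<close> is not identically zero on it even if \<open>F P = 0\<close>.\<close>
  define v where "v = w - P"
  have v: "h v = 0" using w(1) hP by (simp add: v_def h.diff)
  have hPv: "h (P + t *\<^sub>R v) = 0" for t
    using v hP by (simp add: h.add h.scaleR)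
  obtain D C where C: "\<And>j. continuous_on UNIV (C j)"
    and exp: "\<And>x t. F (x + t *\<^sub>R v) = curve D (\<lambda>j. C j x) t"
    using expand[of v] by metis
  have C1: "curve D (\<lambda>j. C j P) 1 \<noteq> 0"
    using w(2) by (simp add: v_def flip: exp[of P 1])
  have C0: "C 0 y = F y" for y using exp[of y 0] by simp
  have Clim: "(\<lambda>k. C j (y k)) \<longlonglongrightarrow> C j P" if "y \<longlonglongrightarrow> P" for y j
    using C[of j] that by (auto simp: continuous_on_eq_continuous_at intro: isCont_tendsto_compose)
  from dichotomy[OF hP nP] show False
  proof (elim disjE exE conjE)
    fix \<gamma> :: "'a \<Rightarrow> complex ^ 'q"
    assume \<gamma>: "isCont \<gamma> P" "\<gamma> P \<noteq> 0"
      "\<forall>x i j. complex_of_real (F x $ i) * \<gamma> x $ j = complex_of_real (F x $ j) * \<gamma> x $ i"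
    \<comment> \<open>\<open>F\<close> has finitely many zeros on the line, so there are nonzero
      values at points of it tending to \<open>P\<close>.\<close>
    have "0 islimpt ({0..3} - {t. curve D (\<lambda>j. C j P) t = 0})"
      by (intro islimpt_Diff_finite islimpt_atLeastAtMost finite_curve_roots[OF C1]) auto
    then obtain t where t: "\<And>k. F (P + t k *\<^sub>R v) \<noteq> 0" "t \<longlonglongrightarrow> 0"
      unfolding islimpt_sequential exp by blast
    have "\<And>k. sgn (F (P + t k *\<^sub>R v)) \<in> B" using EB[OF hPv t(1)] .
    then obtain u' r where r: "u' \<in> B" "strict_mono r" "((\<lambda>k. sgn (F (P + t k *\<^sub>R v))) \<circ> r) \<longlonglongrightarrow> u'"
      using compactB unfolding compact_def by meson
    have "(\<lambda>k. P + t (r k) *\<^sub>R v) \<longlonglongrightarrow> P + 0 *\<^sub>R v"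
      using LIMSEQ_subseq_LIMSEQ[OF t(2) r(2)] by (intro tendsto_intros) (auto simp: o_def)
    then have "u' = a \<or> u' = - a"
      using r cover norm_limits az(2)
      by (intro regular_limits_agree[OF \<gamma>(1,2) \<gamma>(3)[rule_format] x(3,4), of "\<lambda>k. P + t (r k) *\<^sub>R v"])
        (auto simp: o_def)
    then show False using a(1) symA r(1) disj by blast
  next
    fix r M assume r: "0 < r" "\<forall>x\<in>ball P r. \<forall>y\<in>ball P r. h x = h y \<longrightarrow> \<bar>F x $ z\<bar> \<le> M * \<bar>F y $ z\<bar>"
    \<comment> \<open>Half of \<open>r\<close> is reserved for the distance from \<open>x k\<close>
      to \<open>P\<close>, half for the displacement along \<open>v\<close>; the summand 1 keeps the
      denominator positive.\<close>
    define \<epsilon> where "\<epsilon> = r / (2 * (norm v + 1))"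
    have \<epsilon>: "0 < \<epsilon>" using r(1) by (simp add: \<epsilon>_def add_nonneg_pos)
    have \<epsilon>v: "t * norm v < r / 2" if "0 \<le> t" "t \<le> \<epsilon>" for t
    proof -
      have "t * norm v \<le> \<epsilon> * norm v" using that by (intro mult_right_mono) auto
      also have "\<dots> < \<epsilon> * (norm v + 1)" using \<epsilon> by simp
      also have "\<dots> = r / 2" by (simp add: \<epsilon>_def add_nonneg_eq_0_iff field_simps)
      finally show ?thesis .
    qed
    obtain \<delta> where \<delta>: "0 < \<delta>" "\<delta> < 1" "\<And>b :: nat \<Rightarrow> real ^ 'q. (\<Sum>j\<le>D. norm (b j)) = 1 \<Longrightarrow>
        \<exists>c\<in>{2..3}. \<delta> * curve D (\<lambda>j. norm (b j)) c < norm (curve D b c)"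
      using curve_lower_bound[of D] by blast
    obtain \<rho>' where \<rho>': "0 < \<rho>'" "\<And>u u'. u \<in> A \<Longrightarrow> u' \<in> B \<Longrightarrow> \<rho>' \<le> dist u u'"
      using separate_compact_closed[OF compactA clB disj] by blast
    define \<rho> where "\<rho> = \<rho>' / 2"
    have \<rho>: "0 < \<rho>" "\<And>u u'. u \<in> A \<Longrightarrow> u' \<in> B \<Longrightarrow> 2 * \<rho> \<le> dist u u'"
      using \<rho>' by (auto simp: \<rho>_def)
    have "\<forall>\<^sub>F k in sequentially. dist (x k) P < r / 2"
      using x(3) r(1) by (intro tendstoD) auto
    moreover have "\<forall>\<^sub>F k in sequentially. infdist (sgn (F (x k))) A < \<rho>"
      using a(1) \<rho>(1) by (intro order_tendstoD(2)[OF tendsto_infdist[OF x(4)]]) auto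
    ultimately have "\<forall>\<^sub>F k in sequentially. dist (x k) P < r / 2 \<and> infdist (sgn (F (x k))) A < \<rho>"
      by (rule eventually_conj)
    then obtain K where K: "\<And>k. k \<ge> K \<Longrightarrow> dist (x k) P < r / 2 \<and> infdist (sgn (F (x k))) A < \<rho>"
      unfolding eventually_sequentially by blast
    have bnd: "\<bar>F (x k + t *\<^sub>R v) $ z\<bar> \<le> M * \<bar>F (x k) $ z\<bar>" if "k \<ge> K" "0 \<le> t" "t \<le> \<epsilon>" for k t
    proof -
      have d: "dist P (x k) < r / 2" using K[OF that(1)] by (simp add: dist_commute)
      have "dist P (x k + t *\<^sub>R v) \<le> dist P (x k) + t * norm v"
        using dist_triangle[of P "x k + t *\<^sub>R v" "x k"] that(2) by (simp add: dist_norm)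
      also have "\<dots> < r" using \<epsilon>v[OF that(2,3)] d by simp
      finally show ?thesis using r d v by (simp add: h.add h.scaleR)
    qed
    \<comment> \<open>The good scales: the value of \<open>F\<close> is not small against the gauge
      and its direction is still near \<open>A\<close>.\<close>
    define T where "T k = {l. 0 < l \<and> l \<le> \<epsilon> \<and>
      \<delta> * curve D (\<lambda>j. norm (C j (x k))) l \<le> norm (F (x k + l *\<^sub>R v)) \<and>
      infdist (sgn (F (x k + l *\<^sub>R v))) A < \<rho>}" for k
    have T_nonempty: "T k \<noteq> {}" if "k \<ge> K" for k
    proof -
      \<comment> \<open>As the scale tends to 0, the gauge tends to the norm of
        \<open>F (x k)\<close>; since \<open>\<delta> < 1\<close>, all small scales are
        good.\<close>
      have l0: "((\<lambda>l. l) \<longlongrightarrow> 0) (at_right (0::real))" by (rule tendsto_ident_at)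
      have F0: "((\<lambda>l. F (x k + l *\<^sub>R v)) \<longlongrightarrow> F (x k)) (at_right 0)"
        using tendsto_curve[OF tendsto_const l0, of D "\<lambda>j. C j (x k)"] by (simp add: exp C0)
      have "((\<lambda>l. norm (F (x k + l *\<^sub>R v)) - \<delta> * curve D (\<lambda>j. norm (C j (x k))) l)
          \<longlongrightarrow> norm (F (x k)) - \<delta> * curve D (\<lambda>j. norm (C j (x k))) 0) (at_right 0)"
        by (intro tendsto_intros F0 tendsto_curve l0)
      moreover have "0 < norm (F (x k)) - \<delta> * curve D (\<lambda>j. norm (C j (x k))) 0"
        using \<delta>(2) F_nonzero[OF x(2)[of k]] by (simp add: C0)
      ultimately have "\<forall>\<^sub>F l in at_right 0. 0 < norm (F (x k + l *\<^sub>R v)) - \<delta> * curve D (\<lambda>j. norm (C j (x k))) l"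
        by (rule order_tendstoD(1))
      moreover have "\<forall>\<^sub>F l in at_right 0. infdist (sgn (F (x k + l *\<^sub>R v))) A < \<rho>"
        using K[OF that] F_nonzero[OF x(2)[of k]]
        by (intro order_tendstoD(2)[OF tendsto_infdist[OF tendsto_sgn[OF F0]]]) auto
      moreover have "\<forall>\<^sub>F l in at_right 0. l \<in> {0<..<\<epsilon>}"
        using \<epsilon> by (rule eventually_at_right_real)
      ultimately have "\<forall>\<^sub>F l in at_right 0. l \<in> T k"
        by eventually_elim (auto simp: T_def)
      then show ?thesis
        using eventually_happens[of "\<lambda>l. l \<in> T k" "at_right (0::real)"] by auto
    qed
    \<comment> \<open>From some index on, good scales can be doubled: failures at arbitrarily large
      indices would form a sequence contradicting \<open>doubling\<close>. Their indices tend to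
      infinity, so the directions at the base points still converge to \<open>a\<close>.\<close>
    have "\<exists>K'\<ge>K. \<forall>k\<ge>K'. \<forall>l\<in>T k. 3 * l \<le> \<epsilon> \<longrightarrow> (\<exists>l'\<in>T k. 2 * l \<le> l')"
    proof (rule ccontr)
      assume "\<not> ?thesis"
      then have "\<forall>K'. \<exists>k l. K' \<ge> K \<longrightarrow> k \<ge> K' \<and> l \<in> T k \<and> 3 * l \<le> \<epsilon> \<and> (\<forall>l'\<in>T k. \<not> 2 * l \<le> l')"
        by blast
      then obtain \<kappa> l where \<kappa>: "\<And>K'. K' \<ge> K \<Longrightarrow>
          \<kappa> K' \<ge> K' \<and> l K' \<in> T (\<kappa> K') \<and> 3 * l K' \<le> \<epsilon> \<and> (\<forall>l'\<in>T (\<kappa> K'). \<not> 2 * l K' \<le> l')"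
        by metis
      define \<kappa>' where "\<kappa>' k = \<kappa> (k + K)" for k
      define l' where "l' k = l (k + K)" for k
      have \<kappa>': "\<kappa>' k \<ge> k + K" "l' k \<in> T (\<kappa>' k)" "3 * l' k \<le> \<epsilon>" "m \<in> T (\<kappa>' k) \<Longrightarrow> \<not> 2 * l' k \<le> m" for k m
        using \<kappa>[of "k + K"] by (auto simp: \<kappa>'_def l'_def)
      have "filterlim \<kappa>' at_top sequentially"
      proof (rule filterlim_at_top_mono[OF filterlim_ident])
        show "\<forall>\<^sub>F k in sequentially. k \<le> \<kappa>' k"
          using \<kappa>'(1) by (auto intro: always_eventually dest: add_leD1)
      qed
      then have "(\<lambda>k. sgn (F (x (\<kappa>' k)))) \<longlonglongrightarrow> a"
        by (rule filterlim_compose[OF x(4)])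
      from tendsto_vec_nth[OF this, of z] have sz: "(\<lambda>k. sgn (F (x (\<kappa>' k))) $ z) \<longlonglongrightarrow> 0"
        by (simp add: az)
      have "\<exists>k m. 2 * l' k \<le> m \<and> m \<le> \<epsilon> \<and>
          \<delta> * curve D (\<lambda>j. norm (C j (x (\<kappa>' k)))) m \<le> norm (F (x (\<kappa>' k) + m *\<^sub>R v)) \<and>
          infdist (sgn (F (x (\<kappa>' k) + m *\<^sub>R v))) A < \<rho>"
      proof (rule doubling[OF exp v \<delta>(1,3) A \<rho>])
        fix k
        show "h (x (\<kappa>' k)) \<noteq> 0" using x(2) .
        show "3 * l' k \<le> \<epsilon>" using \<kappa>'(3) .
        show "0 < l' k"
          "\<delta> * curve D (\<lambda>j. norm (C j (x (\<kappa>' k)))) (l' k) \<le> norm (F (x (\<kappa>' k) + l' k *\<^sub>R v))"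
          "infdist (sgn (F (x (\<kappa>' k) + l' k *\<^sub>R v))) A < \<rho>"
          using \<kappa>'(2)[of k] by (auto simp: T_def)
      next
        fix k and t :: real assume "0 \<le> t" "t \<le> \<epsilon>"
        then show "\<bar>F (x (\<kappa>' k) + t *\<^sub>R v) $ z\<bar> \<le> M * \<bar>F (x (\<kappa>' k)) $ z\<bar>"
          using bnd \<kappa>'(1)[of k] by auto
      qed (auto intro: sz)
      then obtain k m where m: "2 * l' k \<le> m" "m \<le> \<epsilon>"
          "\<delta> * curve D (\<lambda>j. norm (C j (x (\<kappa>' k)))) m \<le> norm (F (x (\<kappa>' k) + m *\<^sub>R v))"
          "infdist (sgn (F (x (\<kappa>' k) + m *\<^sub>R v))) A < \<rho>"
        by blast
      moreover have "0 < m" using m(1) \<kappa>'(2)[of k] by (auto simp: T_def)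
      ultimately have "m \<in> T (\<kappa>' k)" by (simp add: T_def)
      then show False using \<kappa>'(4) m(1) by blast
    qed
    then obtain K' where K': "K' \<ge> K"
      "\<And>k l. k \<ge> K' \<Longrightarrow> l \<in> T k \<Longrightarrow> 3 * l \<le> \<epsilon> \<Longrightarrow> \<exists>l'\<in>T k. 2 * l \<le> l'"
      by blast
    \<comment> \<open>Good scales beyond \<open>\<epsilon> / 3\<close> have a positive limit scale
      \<open>L\<close> along a subsequence, while the base points tend to \<open>P\<close>.\<close>
    have "\<exists>l\<in>T (k + K'). \<epsilon> < 3 * l" for k
    proof (rule doubling_reaches_end)
      show "T (k + K') \<noteq> {}" using K'(1) by (intro T_nonempty) auto
      show "T (k + K') \<subseteq> {0<..\<epsilon>}" by (auto simp: T_def)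
    qed (use K'(2) in auto)
    then obtain l where l: "\<And>k. l k \<in> T (k + K')" "\<And>k. \<epsilon> < 3 * l k"
      by metis
    have "l k \<in> {\<epsilon> / 3..\<epsilon>}" for k using l(1)[of k] l(2)[of k] by (auto simp: T_def)
    then obtain L q where q: "L \<in> {\<epsilon> / 3..\<epsilon>}" "strict_mono q" "(l \<circ> q) \<longlonglongrightarrow> L"
      using compact_Icc[of "\<epsilon> / 3" \<epsilon>] unfolding compact_def by meson
    define y where "y k = x (q k + K')" for k
    have y: "y \<longlonglongrightarrow> P"
      using LIMSEQ_subseq_LIMSEQ[OF LIMSEQ_ignore_initial_segment[OF x(3)] q(2)] by (simp add: o_def y_def[abs_def])
    have lq: "(\<lambda>k. l (q k)) \<longlonglongrightarrow> L" using q(3) by (simp add: o_def)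
    have Flim: "(\<lambda>k. F (y k + l (q k) *\<^sub>R v)) \<longlonglongrightarrow> F (P + L *\<^sub>R v)"
      unfolding exp by (intro tendsto_curve Clim y lq)
    have yT: "l (q k) \<in> T (q k + K')" for k using l(1) .
    \<comment> \<open>The coefficients at \<open>P\<close> are not all zero because
      \<open>F w \<noteq> 0\<close>. The positive gauge at \<open>L\<close> then bounds the norm of
      \<open>F\<close> at \<open>P + L v\<close> away from 0.\<close>
    have pos: "0 < curve D (\<lambda>j. norm (C j P)) L"
    proof -
      have "\<exists>j\<le>D. C j P \<noteq> 0"
      proof (rule ccontr)
        assume "\<not> ?thesis"
        then have "curve D (\<lambda>j. C j P) 1 = 0" by (simp add: curve_def)
        then show False using C1 by contradiction
      qed
      then obtain j where j: "j \<le> D" "C j P \<noteq> 0" by blast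
      have "0 < L" using q(1) \<epsilon> by auto
      then show ?thesis unfolding curve_def
        using j by (intro sum_pos2[of _ j]) auto
    qed
    have "\<delta> * curve D (\<lambda>j. norm (C j P)) L \<le> norm (F (P + L *\<^sub>R v))"
    proof (rule LIMSEQ_le)
      show "(\<lambda>k. \<delta> * curve D (\<lambda>j. norm (C j (y k))) (l (q k))) \<longlonglongrightarrow> \<delta> * curve D (\<lambda>j. norm (C j P)) L"
        by (intro tendsto_intros tendsto_curve Clim y lq)
      show "(\<lambda>k. norm (F (y k + l (q k) *\<^sub>R v))) \<longlonglongrightarrow> norm (F (P + L *\<^sub>R v))"
        by (intro tendsto_norm Flim)
      show "\<exists>N. \<forall>k\<ge>N. \<delta> * curve D (\<lambda>j. norm (C j (y k))) (l (q k)) \<le> norm (F (y k + l (q k) *\<^sub>R v))"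
        using yT by (auto simp: T_def y_def)
    qed
    then have nz: "F (P + L *\<^sub>R v) \<noteq> 0"
      using mult_pos_pos[OF \<delta>(1) pos] by auto
    \<comment> \<open>The point \<open>P + L v\<close> is at infinity, so its direction is in
      \<open>B\<close>, yet it stays within \<open>\<rho>\<close> of \<open>A\<close>.\<close>
    have "infdist (sgn (F (P + L *\<^sub>R v))) A \<le> \<rho>"
    proof (rule LIMSEQ_le_const2[OF tendsto_infdist[OF tendsto_sgn[OF Flim nz]]], intro exI[of _ 0] allI impI)
      fix k
      show "infdist (sgn (F (y k + l (q k) *\<^sub>R v))) A \<le> \<rho>"
        using yT[of k] by (simp add: T_def y_def)
    qed
    moreover have "2 * \<rho> \<le> infdist (sgn (F (P + L *\<^sub>R v))) A"
      using EB[OF hPv nz] by (intro infdist_far[OF A \<rho>(2)])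
    ultimately show False using \<rho>(1) by linarith
  qed
qed

end

context asymptotic_directions
begin

text \<open>Some direction at infinity exists by \<open>nontrivial\<close>; whichever piece contains
  it, the other piece is empty.\<close>

lemma limits_not_separated:
  assumes "closed A" "closed B" "A \<inter> B = {}" "A \<union> B = limits"
    and "\<And>u. u \<in> A \<Longrightarrow> - u \<in> A" "\<And>u. u \<in> B \<Longrightarrow> - u \<in> B"
  shows "A = {} \<or> B = {}"
proof -
  interpret AB: separated_asymptotic_directions F h z d A B
    using assms by unfold_locales auto
  interpret BA: separated_asymptotic_directions F h z d B A
    using assms by unfold_locales auto
  obtain w where w: "h w = 0" "F w \<noteq> 0" using nontrivial by blast
  then have "sgn (F w) \<in> A \<union> B" using sgn_F_infinity assms(4) by blast
  then show ?thesis
    using AB.no_dirs_opposite_infinity[OF _ w] BA.no_dirs_opposite_infinity[OF _ w] by blast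
qed

end

subsection \<open>Evaluation of multivariate polynomials\<close>

abbreviation mono_eval :: "'a::comm_ring_1 ^ 'n::finite \<Rightarrow> ('n \<Rightarrow>\<^sub>0 nat) \<Rightarrow> 'a" where
  "mono_eval x m \<equiv> \<Prod>i\<in>UNIV. x $ i ^ Poly_Mapping.lookup m i"

lemma peval_superset:
  assumes "finite K" "Poly_Mapping.keys p \<subseteq> K"
  shows "peval p x = (\<Sum>m\<in>K. Poly_Mapping.lookup p m * mono_eval x m)"
  unfolding peval_def using assms by (intro sum.mono_neutral_left) (auto simp: in_keys_iff)

lemma peval_add: "peval (p + q) x = peval p x + peval q x"
proof -
  let ?K = "Poly_Mapping.keys p \<union> Poly_Mapping.keys q"
  have "peval (p + q) x = (\<Sum>m\<in>?K. Poly_Mapping.lookup (p + q) m * mono_eval x m)"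
    by (intro peval_superset) (auto simp: keys_add)
  also have "\<dots> = (\<Sum>m\<in>?K. Poly_Mapping.lookup p m * mono_eval x m)
      + (\<Sum>m\<in>?K. Poly_Mapping.lookup q m * mono_eval x m)"
    by (simp add: lookup_add distrib_right sum.distrib)
  also have "\<dots> = peval p x + peval q x"
    by (simp add: peval_superset[of ?K p] peval_superset[of ?K q])
  finally show ?thesis .
qed

lemma peval_0 [simp]: "peval 0 x = 0"
  by (simp add: peval_def)

lemma peval_single [simp]: "peval (Poly_Mapping.single m c) x = c * mono_eval x m"
  by (subst peval_superset[of "{m}"]) auto

lemma peval_sum: "peval (sum f A) x = (\<Sum>a\<in>A. peval (f a) x)"
  by (induction A rule: infinite_finite_induct) (auto simp: peval_add)

lemma mono_eval_add: "mono_eval x (m + m') = mono_eval x m * mono_eval x m'"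
  by (simp add: lookup_add power_add prod.distrib)

lemma sum_single_lookup: "p = (\<Sum>m\<in>Poly_Mapping.keys p. Poly_Mapping.single m (Poly_Mapping.lookup p m))"
  by (rule poly_mapping_eqI)
    (auto simp: lookup_sum lookup_single when_def in_keys_iff sum.delta if_distrib cong: if_cong)

lemma peval_mult: "peval (p * q) x = peval p x * peval q x"
proof -
  have "p * q = (\<Sum>m\<in>Poly_Mapping.keys p. \<Sum>m'\<in>Poly_Mapping.keys q.
      Poly_Mapping.single (m + m') (Poly_Mapping.lookup p m * Poly_Mapping.lookup q m'))"
    by (subst sum_single_lookup[of p], subst sum_single_lookup[of q]) (simp only: sum_product mult_single)
  then show ?thesis
    by (simp add: peval_sum mono_eval_add peval_def[of p] peval_def[of q] sum_product mult_ac)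
qed

lemma peval_1 [simp]: "peval 1 x = 1"
  using peval_single[of 0 1 x] by (simp only: single_one) simp

lemma peval_power: "peval (p ^ k) x = peval p x ^ k"
  by (induction k) (auto simp: peval_mult)

lemma peval_mvar [simp]: "peval (mvar i) x = x $ i"
proof -
  have "mono_eval x (Poly_Mapping.single i 1) = (\<Prod>j\<in>UNIV. if j = i then x $ j else 1)"
    by (intro prod.cong) (auto simp: lookup_single when_def)
  then show ?thesis by (simp add: mvar_def)
qed

lemma peval_scale:
  assumes "homogeneous k p"
  shows "peval p (c *s x) = c ^ k * peval p x"
proof -
  have "mono_eval (c *s x) m = c ^ k * mono_eval x m" if "m \<in> Poly_Mapping.keys p" for m
    using assms that by (auto simp: homogeneous_def mono_deg_def power_mult_distrib prod.distrib power_sum)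
  then show ?thesis
    by (simp add: peval_def sum_distrib_left mult_ac)
qed

lemma continuous_on_peval:
  fixes p :: "('a::{real_normed_field}, 'n::finite) mpoly"
  assumes "\<And>i. continuous_on S (\<lambda>x. f x $ i)"
  shows "continuous_on S (\<lambda>x. peval p (f x))"
  unfolding peval_def by (intro continuous_intros assms)

lemma keys_complexify [simp]: "Poly_Mapping.keys (complexify p) = Poly_Mapping.keys p"
  by (auto simp: complexify_def in_keys_iff Poly_Mapping.map.rep_eq when_def)

lemma lookup_complexify [simp]:
  "Poly_Mapping.lookup (complexify p) m = complex_of_real (Poly_Mapping.lookup p m)"
  by (auto simp: complexify_def Poly_Mapping.map.rep_eq when_def)

abbreviation complex_vec :: "real ^ 'n \<Rightarrow> complex ^ 'n" where
  "complex_vec x \<equiv> \<chi> j. complex_of_real (x $ j)"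

lemma peval_complexify: "peval (complexify p) (complex_vec x) = complex_of_real (peval p x)"
  by (simp add: peval_def)

lemma homogeneous_complexify [simp]: "homogeneous k (complexify p) \<longleftrightarrow> homogeneous k p"
  by (simp add: homogeneous_def)

text \<open>Induction on the set of variables: with the others fixed, the sum is a polynomial in the
  variable \<open>j\<close> that vanishes everywhere, hence is zero; its coefficient at
  \<open>e m j\<close> collects the monomials with that exponent.\<close>

lemma monomials_independent:
  fixes e :: "'b \<Rightarrow> 'n \<Rightarrow> nat" and a :: "'b \<Rightarrow> 'a::{idom, ring_char_0}"
  assumes "finite J" "finite K"
    and "\<And>m m'. m \<in> K \<Longrightarrow> m' \<in> K \<Longrightarrow> (\<And>i. i \<in> J \<Longrightarrow> e m i = e m' i) \<Longrightarrow> m = m'"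
    and "\<And>x. (\<Sum>m\<in>K. a m * (\<Prod>i\<in>J. x i ^ e m i)) = 0"
    and "m \<in> K"
  shows "a m = 0"
  using assms
proof (induction J arbitrary: K m rule: finite_induct)
  case empty
  then have "K = {m}" by auto
  then show ?case using empty.prems(3) by simp
next
  case (insert j J)
  let ?K = "{m' \<in> K. e m' j = e m j}"
  have "(\<Sum>m\<in>?K. a m * (\<Prod>i\<in>J. x i ^ e m i)) = 0" for x
  proof -
    define p where "p = (\<Sum>m\<in>K. monom (a m * (\<Prod>i\<in>J. x i ^ e m i)) (e m j))"
    have "poly p t = (\<Sum>m\<in>K. a m * (\<Prod>i\<in>insert j J. (x(j := t)) i ^ e m i))" for t
    proof -
      have "(\<Prod>i\<in>J. (x(j := t)) i ^ e m i) = (\<Prod>i\<in>J. x i ^ e m i)" for m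
        using insert.hyps(2) by (intro prod.cong) auto
      then show ?thesis
        using insert.hyps by (simp add: p_def poly_sum poly_monom mult_ac)
    qed
    then have "\<forall>t. poly p t = 0"
      by (simp only: insert.prems(3)) simp
    then have "p = 0" by (simp only: poly_all_0_iff_0)
    then have "coeff p (e m j) = 0" by simp
    then show ?thesis
      by (simp add: p_def coeff_sum coeff_monom sum.inter_filter insert.prems(1))
  qed
  then show ?case
  proof (rule insert.IH[rotated 2])
    fix m1 m2 assume "m1 \<in> ?K" "m2 \<in> ?K" "\<And>i. i \<in> J \<Longrightarrow> e m1 i = e m2 i"
    then show "m1 = m2" by (intro insert.prems(2)) auto
  qed (use insert.prems in auto)
qed

section \<open>Restriction of polynomials to lines\<close>

text \<open>Continuous coefficients and one degree bound for all \<open>x\<close> are what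
  \<open>expand\<close> asks for; in this form the property passes to sums and products.\<close>

definition polynomial_family :: "('x::topological_space \<Rightarrow> real poly) \<Rightarrow> bool" where
  "polynomial_family f \<longleftrightarrow> (\<forall>j. continuous_on UNIV (\<lambda>x. coeff (f x) j)) \<and> (\<exists>D. \<forall>x. degree (f x) \<le> D)"

lemma polynomial_family_const: "polynomial_family (\<lambda>_. p)"
  unfolding polynomial_family_def by auto

lemma polynomial_family_add:
  assumes "polynomial_family f" "polynomial_family g"
  shows "polynomial_family (\<lambda>x. f x + g x)"
proof -
  obtain D E where "\<And>x. degree (f x) \<le> D" "\<And>x. degree (g x) \<le> E"
    using assms unfolding polynomial_family_def by auto
  then have "degree (f x + g x) \<le> max D E" for x
    by (intro degree_add_le) (auto intro: le_max_iff_disj[THEN iffD2])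
  then show ?thesis
    using assms unfolding polynomial_family_def by (auto intro!: continuous_intros)
qed

lemma polynomial_family_mult:
  assumes "polynomial_family f" "polynomial_family g"
  shows "polynomial_family (\<lambda>x. f x * g x)"
proof -
  obtain D E where "\<And>x. degree (f x) \<le> D" "\<And>x. degree (g x) \<le> E"
    using assms unfolding polynomial_family_def by auto
  then have "degree (f x * g x) \<le> D + E" for x
    by (intro order_trans[OF degree_mult_le] add_mono)
  then show ?thesis
    using assms unfolding polynomial_family_def by (auto simp: coeff_mult intro!: continuous_intros)
qed

lemma polynomial_family_sum:
  "(\<And>a. a \<in> A \<Longrightarrow> polynomial_family (f a)) \<Longrightarrow> polynomial_family (\<lambda>x. \<Sum>a\<in>A. f a x)"
  by (induction A rule: infinite_finite_induct) (auto intro: polynomial_family_const polynomial_family_add)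

lemma polynomial_family_prod:
  "(\<And>a. a \<in> A \<Longrightarrow> polynomial_family (f a)) \<Longrightarrow> polynomial_family (\<lambda>x. \<Prod>a\<in>A. f a x)"
  by (induction A rule: infinite_finite_induct) (auto intro: polynomial_family_const polynomial_family_mult)

lemma polynomial_family_power: "polynomial_family f \<Longrightarrow> polynomial_family (\<lambda>x. f x ^ k)"
  by (induction k) (auto intro: polynomial_family_const polynomial_family_mult)

lemma polynomial_family_linear: "polynomial_family (\<lambda>x :: real ^ 'n. [:x $ i, c:])"
  unfolding polynomial_family_def
proof (intro conjI allI exI[of _ 1])
  show "continuous_on UNIV (\<lambda>x :: real ^ 'n. coeff [:x $ i, c:] j)" for j
    by (cases j) (auto simp: coeff_pCons split: nat.split intro!: continuous_intros)
qed auto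

lemma peval_along_line:
  fixes p :: "(real, 'n::finite) mpoly"
  shows "\<exists>f. polynomial_family f \<and> (\<forall>x t. peval p (x + t *\<^sub>R v) = poly (f x) t)"
proof (intro exI conjI allI)
  let ?f = "\<lambda>x. \<Sum>m\<in>Poly_Mapping.keys p. [:Poly_Mapping.lookup p m:] * (\<Prod>i\<in>UNIV. [:x $ i, v $ i:] ^ Poly_Mapping.lookup m i)"
  show "polynomial_family ?f"
    by (intro polynomial_family_sum polynomial_family_mult polynomial_family_const
        polynomial_family_prod polynomial_family_power polynomial_family_linear)
  show "peval p (x + t *\<^sub>R v) = poly (?f x) t" for x t
    by (simp add: peval_def poly_sum poly_prod)
qed

lemma vector_peval_along_line:
  fixes p :: "'q::finite \<Rightarrow> (real, 'n::finite) mpoly"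
  shows "\<exists>D C. (\<forall>j. continuous_on UNIV (C j)) \<and>
    (\<forall>x t. (\<chi> i. peval (p i) (x + t *\<^sub>R v)) = curve D (\<lambda>j. C j x) t)"
proof -
  obtain f where f: "\<And>i. polynomial_family (f i)" "\<And>i x t. peval (p i) (x + t *\<^sub>R v) = poly (f i x) t"
    using peval_along_line[of "p _" v] by metis
  then obtain E where E: "\<And>i x. degree (f i x) \<le> E i"
    unfolding polynomial_family_def by metis
  define D where "D = Max (range E)"
  define C where "C j x = (\<chi> i. coeff (f i x) j)" for j x
  have D: "degree (f i x) \<le> D" for i x
    unfolding D_def by (rule order_trans[OF E]) simp
  have "continuous_on UNIV (C j)" for j
    using f(1) unfolding C_def polynomial_family_def by (auto intro!: continuous_intros)
  moreover have "(\<chi> i. peval (p i) (x + t *\<^sub>R v)) = curve D (\<lambda>j. C j x) t" for x t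
  proof -
    have "poly (f i x) t = (\<Sum>j\<le>D. coeff (f i x) j * t ^ j)" for i
      unfolding poly_altdef using D[of i x]
      by (intro sum.mono_neutral_left) (auto simp: coeff_eq_0 not_le)
    then show ?thesis
      by (simp add: vec_eq_iff curve_def C_def f(2) mult.commute)
  qed
  ultimately show ?thesis by blast
qed

subsection \<open>Points at infinity of the image\<close>

lemma homogeneous_homogenized: "homogeneous (MAX i. total_degree (g i)) (homogenized g j)"
  for g :: "'m::finite option \<Rightarrow> (real, 'n::finite) mpoly"
proof -
  have "mono_deg (homogenize_mono d m) = d" if "mono_deg m \<le> d" for d and m :: "'n \<Rightarrow>\<^sub>0 nat"
  proof -
    have "(\<Sum>i\<in>UNIV. Poly_Mapping.lookup (homogenize_mono d m) i) = d - mono_deg m + mono_deg m"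
      by (simp add: UNIV_option_conv sum.reindex lookup_homogenize_mono mono_deg_def[of m])
    then show ?thesis using that by (simp add: mono_deg_def[of "homogenize_mono d m"])
  qed
  moreover have "mono_deg m \<le> (MAX i. total_degree (g i))" if "m \<in> Poly_Mapping.keys (g j)" for m
  proof -
    have "mono_deg m \<le> total_degree (g j)" using that by (simp add: total_degree_def)
    also have "\<dots> \<le> (MAX i. total_degree (g i))" by simp
    finally show ?thesis .
  qed
  ultimately show ?thesis
    by (auto simp: homogeneous_def homogenized_def keys_homogenize)
qed

text \<open>On \<open>x\<^sub>0 = 0\<close> only the terms of top degree survive, and some component
  has such a term.\<close>

lemma homogenized_nonzero_at_infinity:
  fixes g :: "'m::finite option \<Rightarrow> (real, 'n::finite) mpoly"
  assumes "g j0 \<noteq> 0"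
  shows "\<exists>x j. x $ None = 0 \<and> peval (homogenized g j) x \<noteq> 0"
proof (rule ccontr)
  assume neg: "\<not> ?thesis"
  let ?d = "MAX i. total_degree (g i)"
  have "?d \<in> range (\<lambda>i. total_degree (g i))" by (intro Max_in) auto
  then obtain j where j: "?d = total_degree (g j)" by (rule imageE)
  have "\<exists>j m. m \<in> Poly_Mapping.keys (g j) \<and> mono_deg m = ?d"
  \<comment> \<open>If the maximum is 0, it may be attained by the zero polynomial, so a monomial of
    \<open>g j0\<close> is taken instead.\<close>
  proof (cases "?d = 0")
    case True
    obtain m where m: "m \<in> Poly_Mapping.keys (g j0)" using assms by fastforce
    then have "mono_deg m \<le> total_degree (g j0)" by (simp add: total_degree_def)
    also have "\<dots> \<le> ?d" by simp
    finally show ?thesis using True m by auto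
  next
    case False
    have "total_degree (g j) \<in> insert 0 (mono_deg ` Poly_Mapping.keys (g j))"
      unfolding total_degree_def by (intro Max_in) auto
    then obtain m where "m \<in> Poly_Mapping.keys (g j)" "mono_deg m = ?d" using False j by auto
    then show ?thesis by blast
  qed
  then obtain j m where m: "m \<in> Poly_Mapping.keys (g j)" "mono_deg m = ?d" by blast
  \<comment> \<open>The power of 0 is 1 for monomials of top degree and 0 for the others: it encodes
    the substitution \<open>x\<^sub>0 = 0\<close>.\<close>
  have "Poly_Mapping.lookup (g j) m * 0 ^ (?d - mono_deg m) = 0"
  proof (rule monomials_independent[where J = UNIV and K = "Poly_Mapping.keys (g j)"
        and a = "\<lambda>m. Poly_Mapping.lookup (g j) m * 0 ^ (?d - mono_deg m)" and e = Poly_Mapping.lookup])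
    fix x :: "'n \<Rightarrow> real"
    let ?x = "(\<chi> i. case i of None \<Rightarrow> 0 | Some i \<Rightarrow> x i) :: real ^ 'n option"
    have "peval (homogenized g j) ?x = 0" using neg by auto
    then show "(\<Sum>m\<in>Poly_Mapping.keys (g j). Poly_Mapping.lookup (g j) m * 0 ^ (?d - mono_deg m) *
        (\<Prod>i\<in>UNIV. x i ^ Poly_Mapping.lookup m i)) = 0"
      unfolding homogenized_def peval_def keys_homogenize
      by (simp add: sum.reindex inj_on_def lookup_homogenize prod_UNIV_option lookup_homogenize_mono mult.assoc)
  qed (use m in \<open>auto intro: poly_mapping_eqI\<close>)
  then show False using m by (simp add: in_keys_iff)
qed

lemma abs_proj_eq_scaleE:
  assumes "abs_proj x = abs_proj y" "x \<noteq> 0" "y \<noteq> 0"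
  obtains c where "c \<noteq> 0" "y = c *s x"
  using assms by (auto simp: abs_proj_eq_iff)

lemma abs_proj_in_hyperplane_iff:
  assumes "x \<noteq> 0"
  shows "abs_proj x \<in> hyperplane_at_infinity \<longleftrightarrow> x $ None = 0"
  using assms unfolding hyperplane_at_infinity_def by (force elim: abs_proj_eq_scaleE)

text \<open>\<open>finite_part\<close> holds because \<open>f\<^sub>0\<close> has no real zero,
  \<open>infinite_part\<close> by the condition on the image of the hyperplane, and
  \<open>dichotomy\<close> by the condition on real indeterminacy points.\<close>

lemma asymptotic_directions_homogenized:
  fixes g :: "'m::finite option \<Rightarrow> (real, 'n::finite) mpoly"
  defines "FC \<equiv> \<lambda>j. complexify (homogenized g j)"
  assumes g0: "\<And>x. peval (g None) x \<noteq> 0"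
    and image: "rational_map_image FC hyperplane_at_infinity \<subseteq> hyperplane_at_infinity"
    and F0': "homogenized g None = mvar None ^ e * F0'"
    and regular: "indeterminacy_set FC \<inter> real_points \<inter> proj_zeros (complexify F0') = {}"
  shows "asymptotic_directions (\<lambda>x. \<chi> j. peval (homogenized g j) x) (\<lambda>x. x $ None) None
    (MAX i. total_degree (g i))"
proof (rule asymptotic_directions.intro)
  let ?F = "\<lambda>x. \<chi> j. peval (homogenized g j) x"
  let ?d = "MAX i. total_degree (g i)"
  have hom: "homogeneous ?d (FC j)" for j
    by (simp add: FC_def homogeneous_homogenized)
  have peval_FC: "peval (FC j) (complex_vec x) = complex_of_real (peval (homogenized g j) x)" for j x
    by (simp add: FC_def peval_complexify)
  show "continuous_on UNIV ?F"
    by (intro continuous_on_vec_lambda continuous_on_peval continuous_intros)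
  show "bounded_linear (\<lambda>x :: real ^ 'n option. x $ None)" by (rule bounded_linear_vec_nth)
  show "\<exists>x :: real ^ 'n option. x $ None \<noteq> 0" by (rule exI[of _ 1]) simp
  show scale: "?F (c *\<^sub>R x) = c ^ ?d *\<^sub>R ?F x" for c x
    by (simp add: vec_eq_iff peval_scale[OF homogeneous_homogenized] flip: scalar_mult_eq_scaleR)
  show "\<exists>D C. (\<forall>j. continuous_on UNIV (C j)) \<and> (\<forall>x t. ?F (x + t *\<^sub>R v) = curve D (\<lambda>j. C j x) t)" for v
    by (rule vector_peval_along_line)
  show "?F x $ None \<noteq> 0" if "x $ None \<noteq> 0" for x
    using that g0 by (simp add: homogenized_def peval_homogenize)
  \<comment> \<open>Otherwise \<open>FC\<close> itself would witness a value of the rational map off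
    the hyperplane.\<close>
  have inf: "?F x $ None = 0" if x: "x $ None = 0" "x \<noteq> 0" for x
  proof (rule ccontr)
    assume nz: "?F x $ None \<noteq> 0"
    let ?y = "\<chi> j. peval (FC j) (complex_vec x)"
    have x': "complex_vec x \<noteq> 0" using x(2) by (auto simp: vec_eq_iff)
    have y: "?y $ None \<noteq> 0" using nz by (simp add: peval_FC)
    then have y': "?y \<noteq> 0" by (metis zero_index)
    have "rational_map_value FC (abs_proj (complex_vec x)) (abs_proj ?y)"
      unfolding rational_map_value_def using hom x' y'
      by (intro exI[of _ FC] exI[of _ ?d] exI[of _ "complex_vec x"]) (auto simp: mult.commute)
    moreover have "abs_proj (complex_vec x) \<in> hyperplane_at_infinity"
      using x(1) x' by (simp add: abs_proj_in_hyperplane_iff)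
    ultimately have "abs_proj ?y \<in> hyperplane_at_infinity"
      using image unfolding rational_map_image_def by blast
    then show False using y y' by (simp add: abs_proj_in_hyperplane_iff)
  qed
  \<comment> \<open>The zero vector is no projective point; there homogeneity gives
    \<open>0 ^ ?d\<close> times a component that vanishes, which covers \<open>?d = 0\<close>
    too.\<close>
  show "?F x $ None = 0" if x: "x $ None = 0" for x
  proof (cases "x = 0")
    case True
    let ?e = "axis (Some undefined) 1 :: real ^ 'n option"
    have "?F ?e $ None = 0" by (intro inf) (auto simp: axis_def vec_eq_iff)
    then have "?F (0 *\<^sub>R ?e) $ None = 0" by (simp only: scale vector_scaleR_component mult_zero_right scaleR_zero_right)
    then show ?thesis by (simp add: True)
  qed (use x inf in auto)
  have "g None \<noteq> 0" using g0[of 0] by auto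
  then show "\<exists>w. w $ None = 0 \<and> ?F w \<noteq> 0"
    using homogenized_nonzero_at_infinity[of g None] by (metis vec_lambda_beta zero_index)
  fix P :: "real ^ 'n option" assume P: "P $ None = 0" "norm P = 1"
  show "(\<exists>r>0. \<exists>M. \<forall>x\<in>ball P r. \<forall>y\<in>ball P r. x $ None = y $ None \<longrightarrow>
        \<bar>?F x $ None\<bar> \<le> M * \<bar>?F y $ None\<bar>) \<or>
      (\<exists>\<gamma> :: real ^ 'n option \<Rightarrow> complex ^ 'm option. isCont \<gamma> P \<and> \<gamma> P \<noteq> 0 \<and>
        (\<forall>x i j. complex_of_real (?F x $ i) * \<gamma> x $ j = complex_of_real (?F x $ j) * \<gamma> x $ i))"
  proof (cases "peval F0' P = 0")
    case False
    have "continuous_on UNIV (peval F0')"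
      by (intro continuous_on_peval continuous_intros)
    then have "isCont (peval F0') P" by (simp add: continuous_on_eq_continuous_at)
    then obtain r where r: "0 < r" "\<And>x. dist x P < r \<Longrightarrow> dist (peval F0' x) (peval F0' P) < \<bar>peval F0' P\<bar> / 2"
      using False unfolding continuous_at_eps_delta by (metis half_gt_zero zero_less_abs_iff)
    \<comment> \<open>Near \<open>P\<close> the absolute value of \<open>F\<^sub>0'\<close> lies
      between one half and three halves of its value at \<open>P\<close>, hence the factor 3; the
      powers of \<open>x\<^sub>0\<close> agree at both points.\<close>
    have "\<bar>?F x $ None\<bar> \<le> 3 * \<bar>?F y $ None\<bar>"
      if "x \<in> ball P r" "y \<in> ball P r" and eq: "x $ None = y $ None" for x y
    proof -
      have "\<bar>peval F0' x\<bar> \<le> 3 * \<bar>peval F0' y\<bar>"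
      proof -
        have "\<bar>peval F0' x - peval F0' P\<bar> < \<bar>peval F0' P\<bar> / 2" "\<bar>peval F0' y - peval F0' P\<bar> < \<bar>peval F0' P\<bar> / 2"
          using r(2)[of x] r(2)[of y] that unfolding mem_ball dist_real_def by (simp_all add: dist_commute)
        moreover have "\<bar>peval F0' x\<bar> \<le> \<bar>peval F0' x - peval F0' P\<bar> + \<bar>peval F0' P\<bar>"
          "\<bar>peval F0' P\<bar> \<le> \<bar>peval F0' y - peval F0' P\<bar> + \<bar>peval F0' y\<bar>"
          by linarith+
        ultimately show ?thesis by argo
      qed
      then have "\<bar>(y $ None) ^ e\<bar> * \<bar>peval F0' x\<bar> \<le> \<bar>(y $ None) ^ e\<bar> * (3 * \<bar>peval F0' y\<bar>)"
        by (intro mult_left_mono) auto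
      then show ?thesis
        by (simp add: F0' peval_mult peval_power eq abs_mult mult.left_commute)
    qed
    then show ?thesis using r(1) by blast
  next
    case True
    let ?P = "complex_vec P"
    have P0: "P \<noteq> 0" using P(2) by auto
    then have P': "?P \<noteq> 0" by (auto simp: vec_eq_iff)
    have "abs_proj ?P \<in> real_points" unfolding real_points_def using P0 by blast
    moreover have "abs_proj ?P \<in> proj_zeros (complexify F0')"
      unfolding proj_zeros_def using P' True by (auto simp: peval_complexify)
    ultimately obtain Q where "rational_map_value FC (abs_proj ?P) Q"
      using regular unfolding indeterminacy_set_def by blast
    then obtain G k x where G: "\<And>j. homogeneous k (G j)" "\<And>i j. FC i * G j = FC j * G i"
      and x: "x \<noteq> 0" "abs_proj ?P = abs_proj x" "(\<chi> j. peval (G j) x) \<noteq> 0"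
      unfolding rational_map_value_def by blast
    \<comment> \<open>Homogeneity of the \<open>G j\<close> carries their nonvanishing from the
      representative \<open>x\<close> to \<open>?P\<close>.\<close>
    obtain c where c: "c \<noteq> 0" "x = c *s ?P"
      using abs_proj_eq_scaleE[OF x(2) P' x(1)] by blast
    define \<gamma> where "\<gamma> y = (\<chi> j. peval (G j) (complex_vec y))" for y
    have "\<gamma> P \<noteq> 0"
      using x(3) by (auto simp: c(2) peval_scale[OF G(1)] \<gamma>_def vec_eq_iff)
    moreover have "continuous_on UNIV \<gamma>"
      unfolding \<gamma>_def by (intro continuous_on_vec_lambda continuous_on_peval) (auto intro!: continuous_intros)
    then have "isCont \<gamma> P" by (simp add: continuous_on_eq_continuous_at)
    moreover have "complex_of_real (?F y $ i) * \<gamma> y $ j = complex_of_real (?F y $ j) * \<gamma> y $ i" for y i j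
      using arg_cong[OF G(2)[of i j], of "\<lambda>p. peval p (complex_vec y)"]
      by (simp add: peval_mult peval_FC \<gamma>_def)
    ultimately show ?thesis by blast
  qed
qed

section \<open>From the unit sphere to projective space\<close>

text \<open>\<open>abs_proj\<close> maps \<open>limits\<close> onto the set at infinity and
  identifies opposite vectors, so a separation of the image pulls back to closed symmetric pieces of
  \<open>limits\<close>.\<close>

lemma connected_abs_proj_limits:
  fixes F :: "real ^ 'n::finite option \<Rightarrow> real ^ 'm::finite option"
  assumes "asymptotic_directions F h None d"
  shows "connected (closure {abs_proj (F x) | x. h x \<noteq> 0} \<inter> hyperplane_at_infinity)"
proof -
  interpret asymptotic_directions F h None d by (rule assms)
  let ?X = "{abs_proj (F x) | x. h x \<noteq> 0}"
  let ?T = "closure ?X \<inter> hyperplane_at_infinity"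
  have abs_sgn: "abs_proj (sgn y) = abs_proj y" if "y \<noteq> 0" for y :: "real ^ 'm option"
    using that by (subst abs_proj_eq_iff)
      (auto simp: sgn_zero_iff scalar_mult_eq_scaleR sgn_div_norm intro!: exI[of _ "norm y"])
  have abs_uminus: "abs_proj (- y) = abs_proj y" if "y \<noteq> 0" for y :: "real ^ 'm option"
    using that by (subst abs_proj_eq_iff) (auto simp: vec_eq_iff intro!: exI[of _ "- 1"])
  have nz: "u \<noteq> 0" if "u \<in> limits" for u using norm_limits[OF that] by auto
  have inT: "abs_proj u \<in> ?T" if "u \<in> limits" for u
  proof -
    have "abs_proj u \<in> closure ?X" if u: "u \<in> closure dirs" "u \<noteq> 0" for u
    proof (rule ccontr)
      assume "abs_proj u \<notin> closure ?X"
      moreover have "open (- closure ?X)" by (intro open_Compl closed_closure)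
      ultimately have "u \<in> {x. x \<noteq> 0 \<and> abs_proj x \<in> - closure ?X}"
          and "open {x. x \<noteq> 0 \<and> abs_proj x \<in> - closure ?X}"
        using u(2) by (auto simp only: open_proj_def mem_Collect_eq Compl_iff)
      then have "{x. x \<noteq> 0 \<and> abs_proj x \<in> - closure ?X} \<inter> dirs \<noteq> {}"
        using u(1) open_Int_closure_eq_empty by blast
      then obtain y where "y \<in> dirs" "abs_proj y \<notin> closure ?X" by blast
      moreover obtain x where "h x \<noteq> 0" "y = sgn (F x)"
        using \<open>y \<in> dirs\<close> by (auto simp: dirs_def)
      ultimately show False
        using abs_sgn[OF F_nonzero] closure_subset[of ?X] by auto
    qed
    from this[of u] this[of "- u"] have "abs_proj u \<in> closure ?X"
      using that nz[OF that] abs_uminus[OF nz[OF that]] by (auto simp: limits_def)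
    then show ?thesis
      using that nz[OF that] by (simp add: abs_proj_in_hyperplane_iff limits_def)
  qed
  have fromT: "\<exists>u\<in>limits. p = abs_proj u" if p: "p \<in> ?T" for p
  proof -
    obtain y where y: "p = abs_proj y" "y \<noteq> 0" "y $ None = 0"
      using p by (auto simp: hyperplane_at_infinity_def)
    define u where "u = sgn y"
    have u: "p = abs_proj u" "u \<noteq> 0" "u $ None = 0" "sgn u = u"
      using y abs_sgn[OF y(2)] by (auto simp: u_def sgn_zero_iff sgn_div_norm)
    have "u \<in> closure dirs \<or> - u \<in> closure dirs"
    proof (rule ccontr)
      assume "\<not> ?thesis"
      then have uV: "u \<in> - (closure dirs \<union> uminus ` closure dirs)" by force
      define V where "V = - (closure dirs \<union> uminus ` closure dirs)"
      have V: "open V"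
        unfolding V_def by (intro open_Compl closed_Un closed_negations) auto
      have V': "- v \<in> V" if "v \<in> V" for v
        using that by (force simp: V_def)
      \<comment> \<open>The projective image of the symmetric open set \<open>V\<close>: symmetry
        makes membership independent of the representative, so \<open>?W\<close> is an open
        neighbourhood of \<open>p\<close>, and it misses \<open>?X\<close>.\<close>
      let ?W = "{q. \<exists>y. y \<noteq> 0 \<and> q = abs_proj y \<and> sgn y \<in> V}"
      have sgnV: "sgn x \<in> V" if x: "x \<noteq> 0" "abs_proj x \<in> ?W" for x
      proof -
        from x(2) obtain y where y: "y \<noteq> 0" "abs_proj y = abs_proj x" "sgn y \<in> V"
          unfolding mem_Collect_eq by metis
        obtain c where c: "c \<noteq> 0" "x = c *\<^sub>R y"
          using y(2) abs_proj_eq_iff[OF y(1) x(1)] by (auto simp: scalar_mult_eq_scaleR)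
        then show ?thesis using y(3) V' by (auto simp: sgn_scaleR sgn_real_def)
      qed
      have "{x. x \<noteq> 0 \<and> abs_proj x \<in> ?W} = {x \<in> - {0}. sgn x \<in> V}"
        using sgnV by auto
      moreover have "open {x \<in> - {0 :: real ^ 'm option}. sgn x \<in> V}"
      proof -
        have "continuous_on (- {0 :: real ^ 'm option}) sgn"
          unfolding sgn_div_norm by (intro continuous_intros) auto
        moreover have "open (- {0 :: real ^ 'm option})" by (intro open_Compl closed_singleton)
        ultimately show ?thesis using continuous_open_preimage V
          unfolding vimage_def Int_def by fastforce
      qed
      ultimately have "open ?W" unfolding open_proj_def by simp
      moreover have "p \<in> ?W"
        using u uV by (intro CollectI exI[of _ u]) (simp only: V_def simp_thms)
      moreover have "p \<in> closure ?X" using p by simp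
      ultimately have "?W \<inter> ?X \<noteq> {}"
        using open_Int_closure_eq_empty by blast
      then have "\<exists>q. q \<in> ?W \<inter> ?X" by (simp only: ex_in_conv simp_thms)
      then obtain q where q: "q \<in> ?W" "q \<in> ?X" by (elim exE IntE)
      from q(2) obtain x where qx: "q = abs_proj (F x)" "h x \<noteq> 0"
        unfolding mem_Collect_eq by metis
      have x: "h x \<noteq> 0" "abs_proj (F x) \<in> ?W"
        using qx(2) q(1) unfolding qx(1) .
      then have "sgn (F x) \<in> V" by (intro sgnV F_nonzero)
      moreover have "sgn (F x) \<in> closure dirs"
        using x(1) closure_subset[of dirs] by (auto simp: dirs_def)
      ultimately show False by (simp add: V_def)
    qed
    then show ?thesis using u by (intro bexI[of _ u]) (auto simp: limits_def)
  qed
  show ?thesis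
    unfolding connected_def
  proof (intro notI, elim exE conjE)
    fix U V :: "(real, 'm) proj set"
    assume UV: "open U" "open V" "?T \<subseteq> U \<union> V" "U \<inter> V \<inter> ?T = {}"
      and "U \<inter> ?T \<noteq> {}" "V \<inter> ?T \<noteq> {}"
    then have "\<exists>p. p \<in> U \<inter> ?T" "\<exists>q. q \<in> V \<inter> ?T"
      by (simp_all only: ex_in_conv simp_thms)
    then obtain p q where pq: "p \<in> U" "p \<in> ?T" "q \<in> V" "q \<in> ?T" by (elim exE IntE[of _ _ ?T])
    define A where "A W = {u \<in> limits. abs_proj u \<in> W}" for W
    have A_sym: "- u \<in> A W" if "u \<in> A W" for u W
      using that limits_uminus abs_uminus nz by (auto simp: A_def)
    \<comment> \<open>On \<open>limits\<close>, lying in \<open>W\<close> means avoiding the open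
      set \<open>W'\<close>.\<close>
    have A_cl: "closed (A W)" if "open W'" "\<And>u. u \<in> limits \<Longrightarrow> abs_proj u \<in> W \<longleftrightarrow> abs_proj u \<notin> W'" for W W'
    proof -
      have "A W = limits - {x. x \<noteq> 0 \<and> abs_proj x \<in> W'}"
        using that(2) nz by (auto simp: A_def)
      then show ?thesis
        using that(1) closed_limits unfolding open_proj_def by (simp add: closed_Diff)
    qed
    have excl: "abs_proj u \<in> U \<longleftrightarrow> abs_proj u \<notin> V" if "u \<in> limits" for u
      using inT[OF that] UV(3,4) by blast
    have "A U = {} \<or> A V = {}"
      using excl by (intro limits_not_separated A_cl[of V U] A_cl[of U V] UV A_sym) (auto simp: A_def)
    then show False
      using fromT[OF pq(2)] fromT[OF pq(4)] pq(1,3) unfolding A_def by blast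
  qed
qed

theorem theorem3p3:
  fixes f :: "real^'n::finite \<Rightarrow> real^'m::finite" and S :: "(real^'m) set"
  assumes "semialgebraic S"
    and "quasi_polynomial_map f"
    and "S = range f"
  shows "connected (points_at_infinity S)"
proof -
  obtain g e F0' where g: "represents g f"
    and image: "rational_map_image (\<lambda>j. complexify (homogenized g j)) hyperplane_at_infinity \<subseteq> hyperplane_at_infinity"
    and F0': "homogenized g None = mvar None ^ e * F0'"
      "indeterminacy_set (\<lambda>j. complexify (homogenized g j)) \<inter> real_points \<inter> proj_zeros (complexify F0') = {}"
    using assms(2) unfolding quasi_polynomial_map_def Let_def by blast
  have g0: "peval (g None) x \<noteq> 0" for x
    using g by (simp add: represents_def)
  let ?F = "\<lambda>x. \<chi> j. peval (homogenized g j) x"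
  \<comment> \<open>By dehomogenization \<open>?F x\<close> is a nonzero multiple of the vector with
    entry 1 at \<open>None\<close> and the coordinates of \<open>f\<close> elsewhere.\<close>
  have embed: "abs_proj (?F x) = affine_embed (f (\<chi> i. x $ Some i / x $ None))" if x: "x $ None \<noteq> 0" for x
  proof -
    let ?y = "\<chi> i. x $ Some i / x $ None"
    let ?c = "(x $ None) ^ (MAX i. total_degree (g i)) * peval (g None) ?y"
    let ?u = "\<chi> j. case j of None \<Rightarrow> 1 | Some i \<Rightarrow> f ?y $ i"
    have "?c \<noteq> 0" using x g0 by simp
    moreover have "?F x = ?c *s ?u"
      using g g0[of ?y] x
      by (auto simp: vec_eq_iff represents_def homogenized_def peval_homogenize split: option.split)
    moreover have "?u \<noteq> 0" by (auto simp: vec_eq_iff intro!: exI[of _ None])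
    moreover from calculation have "?F x \<noteq> 0" by (metis vector_mul_eq_0)
    ultimately have "abs_proj ?u = abs_proj (?F x)"
      by (subst abs_proj_eq_iff) blast+
    then show ?thesis by (simp add: affine_embed_def)
  qed
  have "affine_embed ` S = {abs_proj (?F x) | x. x $ None \<noteq> 0}"
  proof (intro equalityI subsetI)
    fix p assume "p \<in> affine_embed ` S"
    then obtain y where "p = affine_embed (f y)" using assms(3) by blast
    then show "p \<in> {abs_proj (?F x) | x. x $ None \<noteq> 0}"
      using embed[of "\<chi> j. case j of None \<Rightarrow> 1 | Some i \<Rightarrow> y $ i"]
      by (auto intro!: exI[of _ "\<chi> j. case j of None \<Rightarrow> 1 | Some i \<Rightarrow> y $ i"])
  qed (use embed assms(3) in auto)
  then show ?thesis
    using connected_abs_proj_limits[OF asymptotic_directions_homogenized[OF g0 image F0']]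
    by (simp add: points_at_infinity_def)
qed

end
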